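(* There is an integer $\sigma$ such that, for every $\varepsilon>0$, no algorithm solves every $n$-vertex instance of Max Cut that is given with a $(\sigma,4)$-hub of size $p$ in time $(2-\varepsilon)^p\cdot n^{\mathcal{O}(1)}$, unless the M3SH fails.
   Context: For a graph $G$, a set $Q\subseteq V(G)$ is a $(\sigma,\delta)$-hub if every connected component of $G-Q$ has at most $\sigma$ vertices and is adjacent to at most $\delta$ vertices of $Q$. Max Cut: given a graph $G$, find a partition of $V(G)$ into two parts maximizing the number of edges with endpoints in different parts. Max 3-Sat: given a CNF formula with at most three literals per clause, find an assignment violating the fewest clauses. M3SH: there is no $\epsilon>0$ such that every $n$-variable Max 3-Sat instance can be solved in time $(2-\epsilon)^n n^{\mathcal{O}(1)}$. *)

theory Defs
  imports Complex_Main "HOL-Library.Discrete_Functions" "HOL-Library.Landau_Symbols"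
begin

section \<open>Algorithms: random access machine programs under logarithmic cost\<close>

text \<open>
  A program works on registers and on arrays (memory banks with indirect addressing), all
  containing natural numbers of arbitrary size. The cost of an operation is the total bit length
  of the numbers it handles, so large numbers cannot be used to hide work. With this convention
  a running time of the form \<open>b\<^sup>n n\<^sup>O\<^sup>(\<^sup>1\<^sup>)\<close> does not depend on the details of the instruction set.
\<close>

type_synonym reg = nat
type_synonym arr = nat

datatype com =
    Skip
  | Const reg nat
  | Add reg reg reg
  | Sub reg reg reg
  | Load reg arr reg
  | Store arr reg reg
  | Seq com com
  | Cond reg com com
  | While reg com

record state =
  regs :: "reg \<Rightarrow> nat"
  arrs :: "arr \<Rightarrow> nat \<Rightarrow> nat"

definition set_reg :: "reg \<Rightarrow> nat \<Rightarrow> state \<Rightarrow> state" where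
  "set_reg x k s = s\<lparr>regs := (regs s)(x := k)\<rparr>"

definition set_arr :: "arr \<Rightarrow> nat \<Rightarrow> nat \<Rightarrow> state \<Rightarrow> state" where
  "set_arr a i k s = s\<lparr>arrs := (arrs s)(a := (arrs s a)(i := k))\<rparr>"

definition bitlen :: "nat \<Rightarrow> nat" where
  "bitlen k = Suc (floor_log k)"

text \<open>
  \<open>exec P s t s'\<close>: started in state \<open>s\<close>, program \<open>P\<close> halts in state \<open>s'\<close> after time \<open>t\<close>.
  Subtraction is truncated; tests check whether a register is nonzero.
\<close>

inductive exec :: "com \<Rightarrow> state \<Rightarrow> nat \<Rightarrow> state \<Rightarrow> bool" where
  Skip: "exec Skip s 1 s"
| Const: "exec (Const x k) s (bitlen k) (set_reg x k s)"
| Add: "exec (Add x y z) s (bitlen (regs s y) + bitlen (regs s z))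
          (set_reg x (regs s y + regs s z) s)"
| Sub: "exec (Sub x y z) s (bitlen (regs s y) + bitlen (regs s z))
          (set_reg x (regs s y - regs s z) s)"
| Load: "exec (Load x a y) s (bitlen (regs s y) + bitlen (arrs s a (regs s y)))
          (set_reg x (arrs s a (regs s y)) s)"
| Store: "exec (Store a x y) s (bitlen (regs s x) + bitlen (regs s y))
          (set_arr a (regs s x) (regs s y) s)"
| Seq: "exec P s t s' \<Longrightarrow> exec P' s' t' s'' \<Longrightarrow> exec (Seq P P') s (t + t') s''"
| Cond_True: "regs s x \<noteq> 0 \<Longrightarrow> exec P s t s' \<Longrightarrow> exec (Cond x P P') s (bitlen (regs s x) + t) s'"
| Cond_False: "regs s x = 0 \<Longrightarrow> exec P' s t s' \<Longrightarrow> exec (Cond x P P') s (bitlen (regs s x) + t) s'"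
| While_True: "regs s x \<noteq> 0 \<Longrightarrow> exec P s t s' \<Longrightarrow> exec (While x P) s' t' s'' \<Longrightarrow>
    exec (While x P) s (bitlen (regs s x) + t + t') s''"
| While_False: "regs s x = 0 \<Longrightarrow> exec (While x P) s (bitlen (regs s x)) s"

inductive_cases SkipE: "exec Skip s t s'"
inductive_cases ConstE: "exec (Const x k) s t s'"
inductive_cases AddE: "exec (Add x y z) s t s'"
inductive_cases SubE: "exec (Sub x y z) s t s'"
inductive_cases LoadE: "exec (Load x a y) s t s'"
inductive_cases StoreE: "exec (Store a x y) s t s'"
inductive_cases SeqE: "exec (Seq P P') s t s'"
inductive_cases CondE: "exec (Cond x P P') s t s'"
inductive_cases WhileE: "exec (While x P) s t s'"

lemma exec_deterministic:
  "exec P s t s' \<Longrightarrow> exec P s u s'' \<Longrightarrow> t = u \<and> s' = s''"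
proof (induction arbitrary: u s'' rule: exec.induct)
  case (Seq P s t s' P' t' s1)
  from Seq.prems show ?case by (rule SeqE) (metis Seq.IH)
next
  case (Cond_True s x P t s' P')
  from Cond_True.prems show ?case by (rule CondE) (use Cond_True.hyps in \<open>auto dest!: Cond_True.IH\<close>)
next
  case (Cond_False s x P' t s' P)
  from Cond_False.prems show ?case by (rule CondE) (use Cond_False.hyps in \<open>auto dest!: Cond_False.IH\<close>)
next
  case (While_True s x P t s' t' s1)
  from While_True.prems show ?case by (rule WhileE) (use While_True.hyps in \<open>auto dest!: While_True.IH\<close>)
next
  case (While_False s x P)
  from While_False.prems show ?case by (rule WhileE) (use While_False.hyps in auto)
qed (erule SkipE ConstE AddE SubE LoadE StoreE, simp)+

text \<open>The input word is in array 0 and its length in register 0; the output is read from array 1.\<close>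

definition input_state :: "nat list \<Rightarrow> state" where
  "input_state w = \<lparr>regs = (\<lambda>x. 0)(0 := length w),
     arrs = (\<lambda>a i. 0)(0 := (\<lambda>i. if i < length w then w ! i else 0))\<rparr>"

definition computes_within :: "com \<Rightarrow> nat list \<Rightarrow> real \<Rightarrow> ((nat \<Rightarrow> nat) \<Rightarrow> bool) \<Rightarrow> bool" where
  "computes_within P w T correct \<longleftrightarrow>
     (\<exists>t s. exec P (input_state w) t s \<and> real t \<le> T \<and> correct (arrs s 1))"

definition poly_bounded :: "(nat \<Rightarrow> nat) \<Rightarrow> bool" where
  "poly_bounded f \<longleftrightarrow> (\<exists>k. (\<lambda>n. real (f n)) \<in> O(\<lambda>n. real n ^ k))"


section \<open>Max 3-Sat\<close>

type_synonym literal = "nat \<times> bool"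
type_synonym clause = "literal set"

text \<open>
  The variables are \<open>0, \<dots>, n - 1\<close>; the literal \<open>(x, b)\<close> is true iff \<open>x\<close> has value \<open>b\<close>.
  A formula is a set of clauses. In particular clauses are not repeated, so that the input size
  is polynomial in \<open>n\<close>; with unlimited repetition no bound in terms of \<open>n\<close> alone would be possible.
\<close>

definition three_cnf :: "nat \<Rightarrow> clause set \<Rightarrow> bool" where
  "three_cnf n F \<longleftrightarrow> (\<forall>C\<in>F. finite C \<and> card C \<le> 3 \<and> fst ` C \<subseteq> {..<n})"

definition violated :: "clause set \<Rightarrow> (nat \<Rightarrow> bool) \<Rightarrow> clause set" where
  "violated F \<alpha> = {C \<in> F. \<forall>(x, b)\<in>C. \<alpha> x \<noteq> b}"

definition max_sat_optimal :: "clause set \<Rightarrow> (nat \<Rightarrow> bool) \<Rightarrow> bool" where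
  "max_sat_optimal F \<alpha> \<longleftrightarrow> (\<forall>\<beta>. card (violated F \<alpha>) \<le> card (violated F \<beta>))"

definition cnf_listing :: "literal list list \<Rightarrow> clause set \<Rightarrow> bool" where
  "cnf_listing cs F \<longleftrightarrow>
     (\<forall>c\<in>set cs. distinct c) \<and> distinct (map set cs) \<and> set (map set cs) = F"

definition encode_clause :: "literal list \<Rightarrow> nat list" where
  "encode_clause c = length c # concat (map (\<lambda>(x, b). [x, of_bool b]) c)"

definition encode_cnf :: "nat \<Rightarrow> literal list list \<Rightarrow> nat list" where
  "encode_cnf n cs = n # length cs # concat (map encode_clause cs)"

definition solves_max_3sat :: "com \<Rightarrow> (nat \<Rightarrow> real) \<Rightarrow> bool" where
  "solves_max_3sat P T \<longleftrightarrow>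
     (\<forall>n F cs. three_cnf n F \<and> cnf_listing cs F \<longrightarrow>
        computes_within P (encode_cnf n cs) (T n)
          (\<lambda>out. max_sat_optimal F (\<lambda>x. out x \<noteq> 0)))"

definition M3SH :: bool where
  "M3SH \<longleftrightarrow> \<not> (\<exists>\<epsilon>::real. \<epsilon> > 0 \<and>
     (\<exists>P f. poly_bounded f \<and> solves_max_3sat P (\<lambda>n. (2 - \<epsilon>) ^ n * real (f n))))"


section \<open>Graphs, hubs and Max Cut\<close>

definition simple_graph :: "'a set \<Rightarrow> 'a set set \<Rightarrow> bool" where
  "simple_graph V E \<longleftrightarrow> finite V \<and> (\<forall>e\<in>E. e \<subseteq> V \<and> card e = 2)"

definition components :: "'a set \<Rightarrow> 'a set set \<Rightarrow> 'a set set" where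
  "components V E = (\<lambda>v. {(x, y). x \<in> V \<and> y \<in> V \<and> {x, y} \<in> E}\<^sup>* `` {v}) ` V"

text \<open>
  Since \<^const>\<open>components\<close> only uses edges inside its first argument, \<open>components (V - Q) E\<close>
  are the components of the graph obtained by deleting \<open>Q\<close>.
\<close>

definition hub :: "nat \<Rightarrow> nat \<Rightarrow> 'a set \<Rightarrow> 'a set set \<Rightarrow> 'a set \<Rightarrow> bool" where
  "hub \<sigma> \<delta> V E Q \<longleftrightarrow> Q \<subseteq> V \<and>
     (\<forall>C\<in>components (V - Q) E. card C \<le> \<sigma> \<and> card {q \<in> Q. \<exists>v\<in>C. {q, v} \<in> E} \<le> \<delta>)"

definition cut_edges :: "'a set \<Rightarrow> 'a set set \<Rightarrow> 'a set \<Rightarrow> 'a set set" where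
  "cut_edges V E A = {e \<in> E. \<exists>u\<in>A. \<exists>v\<in>V - A. e = {u, v}}"

definition is_max_cut :: "'a set \<Rightarrow> 'a set set \<Rightarrow> 'a set \<Rightarrow> bool" where
  "is_max_cut V E A \<longleftrightarrow> A \<subseteq> V \<and>
     (\<forall>B. B \<subseteq> V \<longrightarrow> card (cut_edges V E B) \<le> card (cut_edges V E A))"

definition edge_listing :: "(nat \<times> nat) list \<Rightarrow> nat set set \<Rightarrow> bool" where
  "edge_listing es E \<longleftrightarrow>
     distinct (map (\<lambda>(u, v). {u, v}) es) \<and> set (map (\<lambda>(u, v). {u, v}) es) = E"

definition encode_graph_hub :: "nat \<Rightarrow> (nat \<times> nat) list \<Rightarrow> nat list \<Rightarrow> nat list" where
  "encode_graph_hub n es qs =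
     [n, length es, length qs] @ concat (map (\<lambda>(u, v). [u, v]) es) @ qs"

definition solves_max_cut_with_hub :: "nat \<Rightarrow> nat \<Rightarrow> com \<Rightarrow> (nat \<Rightarrow> nat \<Rightarrow> real) \<Rightarrow> bool" where
  "solves_max_cut_with_hub \<sigma> \<delta> P T \<longleftrightarrow>
     (\<forall>n E Q es qs. simple_graph {..<n} E \<and> hub \<sigma> \<delta> {..<n} E Q \<and>
        edge_listing es E \<and> distinct qs \<and> set qs = Q \<longrightarrow>
        computes_within P (encode_graph_hub n es qs) (T n (card Q))
          (\<lambda>out. is_max_cut {..<n} E {v. v < n \<and> out v \<noteq> 0}))"

end

theory Submission
  imports Defs
begin

text \<open>
  Take the variables and one reference vertex \<open>r\<close>, whose side means ``false'', as the hub. A clause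
  with at most three literals is falsified iff the values \<open>\<ell>\<^sub>1, \<ell>\<^sub>2, \<ell>\<^sub>3\<close> of its literals (padded by
  \<open>r\<close>) all agree with \<open>r\<close>. Its gadget is a \<open>K\<^sub>5\<close> on \<open>r\<close>, three ports \<open>p\<^sub>1, p\<^sub>2, p\<^sub>3\<close> and a free vertex;
  with the best choice of the free vertex this cuts 4 edges if all ports agree with \<open>r\<close> and 6 edges
  otherwise. Each port is linked to its variable by an edge or a path of length two, which gains one
  more cut edge if \<open>p\<^sub>i = \<ell>\<^sub>i\<close>. Hence a gadget contributes at most 12 edges, and at most 11 if the clause
  is falsified (either the \<open>K\<^sub>5\<close> or a link loses), and both values are attained. A maximum cut
  therefore yields an optimal assignment, every component outside the hub has at most 7
  vertices and 4 neighbours in the hub, and the hub has size \<open>n + 1\<close>.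

  The reduction is carried out by a random access machine in polynomially many steps. A step at most
  doubles the largest number, so bit lengths stay small and the logarithmic cost is polynomial too.
  The output of the Max Cut program may contain numbers as long as its running time, so
  decoding costs a polynomial factor times that running time.
\<close>

section \<open>Running times of programs\<close>

definition bounded_state :: "nat \<Rightarrow> state \<Rightarrow> bool" where
  "bounded_state L s \<longleftrightarrow> (\<forall>x. regs s x < 2 ^ L) \<and> (\<forall>a i. arrs s a i < 2 ^ L)"

text \<open>Numbers grow beyond those already in the state only by addition, which adds one bit, or
  by a constant of the program; this measure controls the latter.\<close>

primrec max_const :: "com \<Rightarrow> nat" where
  "max_const Skip = 0"
| "max_const (Const x k) = k"
| "max_const (Add x y z) = 0"
| "max_const (Sub x y z) = 0"
| "max_const (Load x a y) = 0"
| "max_const (Store a x y) = 0"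
| "max_const (Seq P P') = max (max_const P) (max_const P')"
| "max_const (Cond x P P') = max (max_const P) (max_const P')"
| "max_const (While x P) = max_const P"

lemma regs_set_reg [simp]: "regs (set_reg x k s) = (regs s)(x := k)"
  by (simp add: set_reg_def)

lemma arrs_set_reg [simp]: "arrs (set_reg x k s) = arrs s"
  by (simp add: set_reg_def)

lemma regs_set_arr [simp]: "regs (set_arr a i k s) = regs s"
  by (simp add: set_arr_def)

lemma arrs_set_arr [simp]: "arrs (set_arr a i k s) = (arrs s)(a := (arrs s a)(i := k))"
  by (simp add: set_arr_def)

lemma bitlen_le: "k < 2 ^ L \<Longrightarrow> bitlen k \<le> Suc L"
proof -
  assume k: "k < 2 ^ L"
  show ?thesis
  proof (cases "k = 0")
    case False
    then have "2 ^ floor_log k < (2::nat) ^ L"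
      using k floor_log_exp2_le[of k] by linarith
    then show ?thesis
      by (simp add: bitlen_def)
  qed (simp add: bitlen_def)
qed

lemma exec_time_pos: "exec P s t s' \<Longrightarrow> t \<ge> 1"
  by (induction rule: exec.induct) (auto simp: bitlen_def)

lemma bounded_state_mono: "bounded_state L s \<Longrightarrow> L \<le> L' \<Longrightarrow> bounded_state L' s"
  unfolding bounded_state_def by (meson less_le_trans one_le_numeral power_increasing)

lemma bounded_state_set_reg: "bounded_state L s \<Longrightarrow> k < 2 ^ L \<Longrightarrow> bounded_state L (set_reg x k s)"
  by (simp add: bounded_state_def)

lemma bounded_state_set_arr: "bounded_state L s \<Longrightarrow> k < 2 ^ L \<Longrightarrow> bounded_state L (set_arr a i k s)"
  by (simp add: bounded_state_def)

lemma bounded_state_regs: "bounded_state L s \<Longrightarrow> regs s x < 2 ^ L"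
  by (simp add: bounded_state_def)

lemma bounded_state_arrs: "bounded_state L s \<Longrightarrow> arrs s a i < 2 ^ L"
  by (simp add: bounded_state_def)

text \<open>Lets a bound on a number serve directly as a bound on its bit length: wasteful, but
  still polynomial.\<close>

lemma const_less_power: "(k::nat) \<le> L \<Longrightarrow> k < 2 ^ L"
  using less_exp[of L] by linarith

lemma bounded_state_Const:
  "bounded_state L s \<Longrightarrow> k \<le> L \<Longrightarrow> bounded_state L (set_reg x k s)"
  by (intro bounded_state_set_reg const_less_power)

lemma bounded_state_Add:
  assumes "bounded_state L s"
  shows "bounded_state (Suc L) (set_reg x (regs s y + regs s z) s)"
proof (rule bounded_state_set_reg)
  show "bounded_state (Suc L) s"
    using assms by (rule bounded_state_mono) simp
  show "regs s y + regs s z < 2 ^ Suc L"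
    using bounded_state_regs[OF assms, of y] bounded_state_regs[OF assms, of z] by simp
qed

lemma bounded_state_Sub:
  assumes "bounded_state L s"
  shows "bounded_state L (set_reg x (regs s y - regs s z) s)"
  using assms bounded_state_regs[OF assms, of y] by (intro bounded_state_set_reg) linarith+

text \<open>Only an addition needs one more bit, and it costs at least one time unit. This serves
  for the simulated program, about which nothing but its running time is known.\<close>

lemma exec_bounded_state:
  "exec P s t s' \<Longrightarrow> bounded_state L s \<Longrightarrow> max_const P \<le> L \<Longrightarrow> bounded_state (L + t) s'"
proof (induction arbitrary: L rule: exec.induct)
  case (Const x k s)
  then show ?case
    by (auto intro: bounded_state_mono[OF bounded_state_Const])
next
  case (Add x y z s)
  then show ?case
    by (intro bounded_state_mono[OF bounded_state_Add]) (auto simp: bitlen_def)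
next
  case (Sub x y z s)
  then show ?case
    by (auto intro: bounded_state_mono[OF bounded_state_Sub])
next
  case (Load x a y s)
  then show ?case
    by (auto intro!: bounded_state_mono[OF bounded_state_set_reg] bounded_state_arrs)
next
  case (Store a x y s)
  then show ?case
    by (auto intro!: bounded_state_mono[OF bounded_state_set_arr] bounded_state_regs)
next
  case (Seq P s t s' P' t' s'')
  have "bounded_state (L + t) s'"
    using Seq by simp
  then have "bounded_state (L + t + t') s''"
    using Seq by simp
  then show ?case
    by (simp add: ac_simps)
next
  case (While_True s x P t s' t' s'')
  have "bounded_state (L + t) s'"
    using While_True by simp
  then have "bounded_state (L + t + t') s''"
    using While_True by simp
  then show ?case
    by (rule bounded_state_mono) simp
next
  case (Cond_True s x P t s' P')
  then have "bounded_state (L + t) s'"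
    by simp
  then show ?case
    by (rule bounded_state_mono) simp
next
  case (Cond_False s x P' t s' P)
  then have "bounded_state (L + t) s'"
    by simp
  then show ?case
    by (rule bounded_state_mono) simp
qed (auto elim: bounded_state_mono)

section \<open>Step counts and the logarithmic cost they imply\<close>

text \<open>
  \<open>k\<close> bounds the number of unit-cost steps; each step increases the bit length of the largest
  number by at most one, whence the bound on the logarithmic cost.
\<close>

definition runs :: "com \<Rightarrow> state \<Rightarrow> nat \<Rightarrow> state \<Rightarrow> bool" where
  "runs P s k s' \<longleftrightarrow> (\<forall>L. max_const P \<le> L \<longrightarrow> bounded_state L s \<longrightarrow>
     (\<exists>t. exec P s t s' \<and> t \<le> k * (2 * (L + k) + 2) \<and> bounded_state (L + k) s'))"

lemma runs_mono:
  assumes "runs P s k s'" "k \<le> k'"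
  shows "runs P s k' s'"
  unfolding runs_def
proof (intro allI impI)
  fix L
  assume "max_const P \<le> L" "bounded_state L s"
  then obtain t where t: "exec P s t s'" "t \<le> k * (2 * (L + k) + 2)" "bounded_state (L + k) s'"
    using assms(1) by (auto simp: runs_def)
  have "k * (2 * (L + k) + 2) \<le> k' * (2 * (L + k') + 2)"
    using assms(2) by (intro mult_mono) auto
  then show "\<exists>t. exec P s t s' \<and> t \<le> k' * (2 * (L + k') + 2) \<and> bounded_state (L + k') s'"
    using t assms(2) by (meson bounded_state_mono add_left_mono le_trans)
qed

text \<open>The second alternative for \<open>t\<close> is for \<open>Const\<close>, whose cost
  depends on the constant and not on the numbers in the state.\<close>

lemma runs_atomic:
  assumes "exec P s t s'"
    and "\<And>L. bounded_state L s \<Longrightarrow> t \<le> 2 * L + 2 \<or> t \<le> Suc (max_const P)"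
    and "\<And>L. bounded_state L s \<Longrightarrow> max_const P \<le> L \<Longrightarrow> bounded_state (Suc L) s'"
  shows "runs P s 1 s'"
  unfolding runs_def
proof (intro allI impI exI conjI)
  fix L assume "max_const P \<le> L" "bounded_state L s"
  then show "t \<le> 1 * (2 * (L + 1) + 2)" "bounded_state (L + 1) s'"
    using assms(2)[of L] assms(3)[of L] by auto
qed (rule assms(1))

lemma runs_Skip: "runs Skip s 1 s"
  by (rule runs_atomic[OF exec.Skip]) (auto elim: bounded_state_mono)

lemma runs_Const: "runs (Const x k) s 1 (set_reg x k s)"
proof (rule runs_atomic[OF exec.Const])
  show "bitlen k \<le> 2 * L + 2 \<or> bitlen k \<le> Suc (max_const (Const x k))" for L
    using bitlen_le[of k k] by simp
qed (auto intro: bounded_state_mono[OF bounded_state_Const])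

lemma bitlen_add_le: "j < 2 ^ L \<Longrightarrow> k < 2 ^ L \<Longrightarrow> bitlen j + bitlen k \<le> Suc (Suc (2 * L))"
  using bitlen_le[of j L] bitlen_le[of k L] by simp

lemma runs_Add: "runs (Add x y z) s 1 (set_reg x (regs s y + regs s z) s)"
  by (rule runs_atomic[OF exec.Add])
    (auto intro!: disjI1 bitlen_add_le bounded_state_regs bounded_state_Add)

lemma runs_Sub: "runs (Sub x y z) s 1 (set_reg x (regs s y - regs s z) s)"
  by (rule runs_atomic[OF exec.Sub])
    (auto intro!: disjI1 bitlen_add_le bounded_state_regs bounded_state_mono[OF bounded_state_Sub])

lemma runs_Load: "runs (Load x a y) s 1 (set_reg x (arrs s a (regs s y)) s)"
  by (rule runs_atomic[OF exec.Load])
    (auto intro!: disjI1 bitlen_add_le bounded_state_regs bounded_state_arrs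
      bounded_state_mono[OF bounded_state_set_reg])

lemma runs_Store: "runs (Store a x y) s 1 (set_arr a (regs s x) (regs s y) s)"
  by (rule runs_atomic[OF exec.Store])
    (auto intro!: disjI1 bitlen_add_le bounded_state_regs
      bounded_state_mono[OF bounded_state_set_arr])

text \<open>The second program starts with bound \<open>L + k\<close> on the bit length, so step
  counts add up and both costs fit under the bound for \<open>k + k'\<close>.\<close>

lemma runs_Seq:
  assumes "runs P s k s'" "runs P' s' k' s''"
  shows "runs (Seq P P') s (k + k') s''"
  unfolding runs_def
proof (intro allI impI)
  fix L
  assume L: "max_const (Seq P P') \<le> L" "bounded_state L s"
  obtain t where t: "exec P s t s'" "t \<le> k * (2 * (L + k) + 2)" "bounded_state (L + k) s'"
    using assms(1) L by (auto simp: runs_def)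
  obtain t' where t': "exec P' s' t' s''" "t' \<le> k' * (2 * (L + k + k') + 2)"
    "bounded_state (L + k + k') s''"
    using assms(2)[unfolded runs_def, rule_format, of "L + k"] L t(3) by auto
  have "t + t' \<le> (k + k') * (2 * (L + (k + k')) + 2)"
    using t(2) t'(2) by (simp add: algebra_simps)
  then show "\<exists>t. exec (Seq P P') s t s'' \<and> t \<le> (k + k') * (2 * (L + (k + k')) + 2) \<and>
      bounded_state (L + (k + k')) s''"
    using exec.Seq[OF t(1) t'(1)] t'(3) by (auto simp: ac_simps)
qed

lemma runs_Cond:
  assumes "regs s x \<noteq> 0 \<Longrightarrow> runs P s k s'" "regs s x = 0 \<Longrightarrow> runs P' s k s'"
  shows "runs (Cond x P P') s (Suc k) s'"
  unfolding runs_def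
proof (intro allI impI)
  fix L
  assume L: "max_const (Cond x P P') \<le> L" "bounded_state L s"
  have b: "bitlen (regs s x) \<le> Suc L"
    using L by (intro bitlen_le bounded_state_regs)
  obtain t where t: "exec (Cond x P P') s (bitlen (regs s x) + t) s'"
    "t \<le> k * (2 * (L + k) + 2)" "bounded_state (L + k) s'"
  proof (cases "regs s x = 0")
    case True
    then show ?thesis
      using assms(2) L that exec.Cond_False[of s x P' _ s' P] by (auto simp: runs_def)
  next
    case False
    then show ?thesis
      using assms(1) L that exec.Cond_True[of s x P _ s' P'] by (auto simp: runs_def)
  qed
  have "bitlen (regs s x) + t \<le> Suc k * (2 * (L + Suc k) + 2)"
    using t(2) b by (simp add: algebra_simps)
  then show "\<exists>t. exec (Cond x P P') s t s' \<and> t \<le> Suc k * (2 * (L + Suc k) + 2) \<and>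
      bounded_state (L + Suc k) s'"
    using t(1,3) by (meson bounded_state_mono add_left_mono lessI less_imp_le)
qed

lemma runs_While_False: "regs s x = 0 \<Longrightarrow> runs (While x P) s 1 s"
  by (rule runs_atomic[OF exec.While_False]) (auto simp: bitlen_def elim: bounded_state_mono)

lemma runs_While_True:
  assumes "regs s x \<noteq> 0" "runs P s k s'" "runs (While x P) s' k' s''"
  shows "runs (While x P) s (Suc (k + k')) s''"
  unfolding runs_def
proof (intro allI impI)
  fix L
  assume L: "max_const (While x P) \<le> L" "bounded_state L s"
  have b: "bitlen (regs s x) \<le> Suc L"
    using L by (intro bitlen_le bounded_state_regs)
  obtain t where t: "exec P s t s'" "t \<le> k * (2 * (L + k) + 2)" "bounded_state (L + k) s'"
    using assms(2) L by (auto simp: runs_def)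
  obtain t' where t': "exec (While x P) s' t' s''" "t' \<le> k' * (2 * (L + k + k') + 2)"
    "bounded_state (L + k + k') s''"
    using assms(3)[unfolded runs_def, rule_format, of "L + k"] L t(3) by auto
  have "bitlen (regs s x) + t + t' \<le> Suc (k + k') * (2 * (L + Suc (k + k')) + 2)"
    using t(2) t'(2) b by (simp add: algebra_simps)
  moreover have "bounded_state (L + Suc (k + k')) s''"
    using t'(3) by (rule bounded_state_mono) simp
  ultimately show "\<exists>t. exec (While x P) s t s'' \<and> t \<le> Suc (k + k') * (2 * (L + Suc (k + k')) + 2) \<and>
      bounded_state (L + Suc (k + k')) s''"
    using exec.While_True[OF assms(1) t(1) t'(1)] by blast
qed

text \<open>Without loops the final state is a function of the initial one, so the simplifier can
  evaluate loop bodies; each loop then needs just one induction.\<close>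

primrec loop_free :: "com \<Rightarrow> bool" where
  "loop_free Skip \<longleftrightarrow> True"
| "loop_free (Const x k) \<longleftrightarrow> True"
| "loop_free (Add x y z) \<longleftrightarrow> True"
| "loop_free (Sub x y z) \<longleftrightarrow> True"
| "loop_free (Load x a y) \<longleftrightarrow> True"
| "loop_free (Store a x y) \<longleftrightarrow> True"
| "loop_free (Seq P P') \<longleftrightarrow> loop_free P \<and> loop_free P'"
| "loop_free (Cond x P P') \<longleftrightarrow> loop_free P \<and> loop_free P'"
| "loop_free (While x P) \<longleftrightarrow> False"

text \<open>Only meaningful for loop-free programs; loops are skipped.\<close>

primrec apply_com :: "com \<Rightarrow> state \<Rightarrow> state" where
  "apply_com Skip s = s"
| "apply_com (Const x k) s = set_reg x k s"
| "apply_com (Add x y z) s = set_reg x (regs s y + regs s z) s"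
| "apply_com (Sub x y z) s = set_reg x (regs s y - regs s z) s"
| "apply_com (Load x a y) s = set_reg x (arrs s a (regs s y)) s"
| "apply_com (Store a x y) s = set_arr a (regs s x) (regs s y) s"
| "apply_com (Seq P P') s = apply_com P' (apply_com P s)"
| "apply_com (Cond x P P') s = (if regs s x \<noteq> 0 then apply_com P s else apply_com P' s)"
| "apply_com (While x P) s = s"

primrec steps :: "com \<Rightarrow> nat" where
  "steps Skip = 1"
| "steps (Const x k) = 1"
| "steps (Add x y z) = 1"
| "steps (Sub x y z) = 1"
| "steps (Load x a y) = 1"
| "steps (Store a x y) = 1"
| "steps (Seq P P') = steps P + steps P'"
| "steps (Cond x P P') = Suc (max (steps P) (steps P'))"
| "steps (While x P) = 1"

lemma runs_loop_free: "loop_free P \<Longrightarrow> runs P s (steps P) (apply_com P s)"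
proof (induction P arbitrary: s)
  case (Seq P P')
  then have "runs P s (steps P) (apply_com P s)"
    "runs P' (apply_com P s) (steps P') (apply_com P' (apply_com P s))"
    by simp_all
  from runs_Seq[OF this] show ?case
    by simp
next
  case (Cond x P P')
  have "runs P s (max (steps P) (steps P')) (apply_com P s)"
    by (rule runs_mono[of P s "steps P"]) (use Cond in auto)
  moreover have "runs P' s (max (steps P) (steps P')) (apply_com P' s)"
    by (rule runs_mono[of P' s "steps P'"]) (use Cond in auto)
  ultimately show ?case
    using runs_Cond[of s x P _ "apply_com (Cond x P P') s" P'] by simp
next
  case Skip
  show ?case
    using runs_Skip[of s] by simp
next
  case (Const x k)
  show ?case
    using runs_Const[of x k s] by simp
next
  case (Add x y z)
  show ?case
    using runs_Add[of x y z s] by simp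
next
  case (Sub x y z)
  show ?case
    using runs_Sub[of x y z s] by simp
next
  case (Load x a y)
  show ?case
    using runs_Load[of x a y s] by simp
next
  case (Store a x y)
  show ?case
    using runs_Store[of a x y s] by simp
qed simp

text \<open>Each round costs the body and one test; the summand 1 is the final test that fails. The
  form matches an induction on the number \<open>m\<close> of rounds.\<close>

lemma runs_While_step:
  assumes "loop_free P" "regs s x \<noteq> 0" "runs (While x P) (apply_com P s) (m * Suc (steps P) + 1) s'"
  shows "runs (While x P) s (Suc m * Suc (steps P) + 1) s'"
  using runs_While_True[OF assms(2) runs_loop_free[OF assms(1)] assms(3)] by (simp add: add.left_commute)

section \<open>Simulating a program on renamed registers and arrays\<close>

text \<open>The shift leaves the first \<open>d\<close> registers and arrays to the caller.\<close>

primrec shift :: "nat \<Rightarrow> com \<Rightarrow> com" where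
  "shift d Skip = Skip"
| "shift d (Const x k) = Const (d + x) k"
| "shift d (Add x y z) = Add (d + x) (d + y) (d + z)"
| "shift d (Sub x y z) = Sub (d + x) (d + y) (d + z)"
| "shift d (Load x a y) = Load (d + x) (d + a) (d + y)"
| "shift d (Store a x y) = Store (d + a) (d + x) (d + y)"
| "shift d (Seq P P') = Seq (shift d P) (shift d P')"
| "shift d (Cond x P P') = Cond (d + x) (shift d P) (shift d P')"
| "shift d (While x P) = While (d + x) (shift d P)"

lemma max_const_shift [simp]: "max_const (shift d P) = max_const P"
  by (induction P) auto

definition drop_state :: "nat \<Rightarrow> state \<Rightarrow> state" where
  "drop_state d s = \<lparr>regs = (\<lambda>x. regs s (d + x)), arrs = (\<lambda>a. arrs s (d + a))\<rparr>"

definition same_below :: "nat \<Rightarrow> state \<Rightarrow> state \<Rightarrow> bool" where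
  "same_below d s s' \<longleftrightarrow> (\<forall>x<d. regs s' x = regs s x \<and> arrs s' x = arrs s x)"

lemma regs_drop_state [simp]: "regs (drop_state d s) x = regs s (d + x)"
  by (simp add: drop_state_def)

lemma arrs_drop_state [simp]: "arrs (drop_state d s) a = arrs s (d + a)"
  by (simp add: drop_state_def)

lemma drop_state_set_reg: "drop_state d (set_reg (d + x) k s) = set_reg x k (drop_state d s)"
  by (simp add: drop_state_def set_reg_def fun_eq_iff)

lemma drop_state_set_arr: "drop_state d (set_arr (d + a) i k s) = set_arr a i k (drop_state d s)"
  by (simp add: drop_state_def set_arr_def fun_eq_iff)

lemma same_below_refl: "same_below d s s"
  by (simp add: same_below_def)

lemma same_below_set_reg: "same_below d s (set_reg (d + x) k s)"
  by (simp add: same_below_def)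

lemma same_below_set_arr: "same_below d s (set_arr (d + x) i k s)"
  by (simp add: same_below_def)

lemma same_below_trans: "same_below d s s' \<Longrightarrow> same_below d s' s'' \<Longrightarrow> same_below d s s''"
  by (simp add: same_below_def)

text \<open>Renaming registers and arrays changes none of the numbers handled, and cost is charged
  only for those. Hence the time is the same, while \<open>same_below\<close> protects the data of
  the caller.\<close>

lemma exec_shift:
  assumes "exec P s t s'" "drop_state d S = s"
  shows "\<exists>S'. exec (shift d P) S t S' \<and> drop_state d S' = s' \<and> same_below d S S'"
  using assms
proof (induction arbitrary: S rule: exec.induct)
  case (Skip s)
  then show ?case
    using exec.Skip same_below_refl by fastforce
next
  case (Const x k s)
  then show ?case
    using exec.Const drop_state_set_reg same_below_set_reg by fastforce
next
  case (Add x y z s)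
  then show ?case
    using exec.Add[of "d + x" "d + y" "d + z" S] drop_state_set_reg same_below_set_reg by fastforce
next
  case (Sub x y z s)
  then show ?case
    using exec.Sub[of "d + x" "d + y" "d + z" S] drop_state_set_reg same_below_set_reg by fastforce
next
  case (Load x a y s)
  then show ?case
    using exec.Load[of "d + x" "d + a" "d + y" S] drop_state_set_reg same_below_set_reg by fastforce
next
  case (Store a x y s)
  then show ?case
    using exec.Store[of "d + a" "d + x" "d + y" S] drop_state_set_arr same_below_set_arr by fastforce
next
  case (Seq P s t s' P' t' s'')
  obtain S' where S': "exec (shift d P) S t S'" "drop_state d S' = s'" "same_below d S S'"
    using Seq.IH(1)[OF Seq.prems] by blast
  obtain S'' where S'': "exec (shift d P') S' t' S''" "drop_state d S'' = s''" "same_below d S' S''"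
    using Seq.IH(2)[OF S'(2)] by blast
  show ?case
    using exec.Seq[OF S'(1) S''(1)] S''(2) same_below_trans[OF S'(3) S''(3)] by auto
next
  case (Cond_True s x P t s' P')
  obtain S' where S': "exec (shift d P) S t S'" "drop_state d S' = s'" "same_below d S S'"
    using Cond_True.IH[OF Cond_True.prems] by blast
  have "regs S (d + x) = regs s x"
    using Cond_True.prems by auto
  then show ?case
    using exec.Cond_True[OF _ S'(1), of "d + x" "shift d P'"] Cond_True.hyps S' by auto
next
  case (Cond_False s x P' t s' P)
  obtain S' where S': "exec (shift d P') S t S'" "drop_state d S' = s'" "same_below d S S'"
    using Cond_False.IH[OF Cond_False.prems] by blast
  have "regs S (d + x) = regs s x"
    using Cond_False.prems by auto
  then show ?case
    using exec.Cond_False[OF _ S'(1), of "d + x" "shift d P"] Cond_False.hyps S' by auto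
next
  case (While_True s x P t s' t' s'')
  obtain S' where S': "exec (shift d P) S t S'" "drop_state d S' = s'" "same_below d S S'"
    using While_True.IH(1)[OF While_True.prems] by blast
  obtain S'' where S'': "exec (While (d + x) (shift d P)) S' t' S''" "drop_state d S'' = s''"
    "same_below d S' S''"
    using While_True.IH(2)[OF S'(2)] by auto
  have "regs S (d + x) = regs s x"
    using While_True.prems by auto
  then show ?case
    using exec.While_True[OF _ S'(1) S''(1)] While_True.hyps S''(2) same_below_trans[OF S'(3) S''(3)]
    by auto
next
  case (While_False s x P)
  have "regs S (d + x) = regs s x"
    using While_False.prems by auto
  then show ?case
    using exec.While_False[of S "d + x" "shift d P"] While_False same_below_refl by auto
qed

section \<open>The graph of a formula\<close>

text \<open>The reference vertex \<open>n\<close> always counts as false, so the literal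
  \<open>(n, True)\<close> never satisfies a clause. Three copies suffice even for the empty
  clause.\<close>

definition pad_clause :: "nat \<Rightarrow> literal list \<Rightarrow> literal list" where
  "pad_clause n c = take 3 (c @ replicate 3 (n, True))"

text \<open>A positive literal attaches its variable to the inner vertex, giving a path of length
  two whose ends agree if both edges are cut. A negative literal attaches it to the port itself; the
  inner vertex is then pendant and its edge can always be cut. Both cases have two edges, so every
  clause is treated uniformly.\<close>

definition literal_edge :: "nat \<Rightarrow> nat \<Rightarrow> literal list \<Rightarrow> nat \<Rightarrow> nat \<times> nat" where
  "literal_edge n b c j = (fst (pad_clause n c ! j), b + 2 * j + of_bool (snd (pad_clause n c ! j)))"

text \<open>
  The vertices of the block at \<open>b\<close> are the ports \<open>b + 2j\<close>, the inner vertices \<open>b + 2j + 1\<close> of the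
  links, and the free vertex \<open>b + 6\<close>; the reference vertex is \<open>n\<close>.
\<close>

definition gadget :: "nat \<Rightarrow> nat \<Rightarrow> literal list \<Rightarrow> (nat \<times> nat) list" where
  "gadget n b c =
     [literal_edge n b c 0, literal_edge n b c 1, literal_edge n b c 2,
      (b, b + 1), (b + 2, b + 3), (b + 4, b + 5),
      (n, b), (n, b + 2), (n, b + 4), (n, b + 6),
      (b, b + 2), (b, b + 4), (b, b + 6), (b + 2, b + 4), (b + 2, b + 6), (b + 4, b + 6)]"

primrec graph_edges :: "nat \<Rightarrow> nat \<Rightarrow> literal list list \<Rightarrow> (nat \<times> nat) list" where
  "graph_edges n b [] = []"
| "graph_edges n b (c # cs) = gadget n b c @ graph_edges n (b + 7) cs"

text \<open>Counting along a list makes the cut additive over gadgets; \<open>card_cut_edges\<close>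
  translates back to sets of edges.\<close>

definition cut_value :: "(nat \<times> nat) list \<Rightarrow> (nat \<Rightarrow> bool) \<Rightarrow> nat" where
  "cut_value es a = length (filter (\<lambda>(u, v). a u \<noteq> a v) es)"

definition falsified :: "(nat \<Rightarrow> bool) \<Rightarrow> literal list \<Rightarrow> bool" where
  "falsified \<alpha> c \<longleftrightarrow> (\<forall>(x, b)\<in>set c. \<alpha> x \<noteq> b)"

lemma cut_value_Nil [simp]: "cut_value [] a = 0"
  by (simp add: cut_value_def)

lemma cut_value_Cons [simp]: "cut_value ((u, v) # es) a = of_bool (a u \<noteq> a v) + cut_value es a"
  by (simp add: cut_value_def)

lemma cut_value_append [simp]: "cut_value (es @ es') a = cut_value es a + cut_value es' a"
  by (simp add: cut_value_def)

lemma length_pad_clause: "length (pad_clause n c) = 3"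
  by (simp add: pad_clause_def)

lemma pad_clause_cases:
  obtains x\<^sub>0 b\<^sub>0 x\<^sub>1 b\<^sub>1 x\<^sub>2 b\<^sub>2 where "pad_clause n c = [(x\<^sub>0, b\<^sub>0), (x\<^sub>1, b\<^sub>1), (x\<^sub>2, b\<^sub>2)]"
proof -
  obtain l\<^sub>0 l\<^sub>1 l\<^sub>2 where "pad_clause n c = [l\<^sub>0, l\<^sub>1, l\<^sub>2]"
    using length_pad_clause[of n c] by (auto simp: numeral_eq_Suc length_Suc_conv)
  then show ?thesis
    using that by (cases l\<^sub>0; cases l\<^sub>1; cases l\<^sub>2) blast
qed

lemma set_pad_clause: "length c \<le> 3 \<Longrightarrow> set c \<subseteq> set (pad_clause n c)"
  and pad_clause_subset: "length c \<le> 3 \<Longrightarrow> set (pad_clause n c) \<subseteq> insert (n, True) (set c)"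
  by (auto simp: pad_clause_def set_replicate_conv_if split: if_splits)

lemma falsified_pad_clause:
  assumes "length c \<le> 3" "\<not> \<alpha> n"
  shows "falsified \<alpha> (pad_clause n c) \<longleftrightarrow> falsified \<alpha> c"
  using assms set_pad_clause[OF assms(1), of n] pad_clause_subset[OF assms(1), of n]
  unfolding falsified_def by fast

lemma gadget_padded:
  assumes "pad_clause n c = [(x\<^sub>0, b\<^sub>0), (x\<^sub>1, b\<^sub>1), (x\<^sub>2, b\<^sub>2)]"
  shows "gadget n b c =
     [(x\<^sub>0, b + of_bool b\<^sub>0), (x\<^sub>1, b + 2 + of_bool b\<^sub>1), (x\<^sub>2, b + 4 + of_bool b\<^sub>2),
      (b, b + 1), (b + 2, b + 3), (b + 4, b + 5),
      (n, b), (n, b + 2), (n, b + 4), (n, b + 6),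
      (b, b + 2), (b, b + 4), (b, b + 6), (b + 2, b + 4), (b + 2, b + 6), (b + 4, b + 6)]"
  by (simp add: gadget_def literal_edge_def assms)

section \<open>The maximum cut of a single gadget\<close>

definition k5 :: "bool \<Rightarrow> bool \<Rightarrow> bool \<Rightarrow> bool \<Rightarrow> bool \<Rightarrow> nat" where
  "k5 r p\<^sub>0 p\<^sub>1 p\<^sub>2 h = of_bool (r \<noteq> p\<^sub>0) + of_bool (r \<noteq> p\<^sub>1) + of_bool (r \<noteq> p\<^sub>2) + of_bool (r \<noteq> h) +
     of_bool (p\<^sub>0 \<noteq> p\<^sub>1) + of_bool (p\<^sub>0 \<noteq> p\<^sub>2) + of_bool (p\<^sub>0 \<noteq> h) + of_bool (p\<^sub>1 \<noteq> p\<^sub>2) +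
     of_bool (p\<^sub>1 \<noteq> h) + of_bool (p\<^sub>2 \<noteq> h)"

definition link :: "bool \<Rightarrow> bool \<Rightarrow> bool \<Rightarrow> bool \<Rightarrow> nat" where
  "link x b p q = of_bool (x \<noteq> (if b then q else p)) + of_bool (p \<noteq> q)"

text \<open>Splitting five vertices into \<open>i\<close> and \<open>5 - i\<close> cuts
  \<open>i * (5 - i)\<close> edges: at most 6, and at most 4 if four of them are together.\<close>

lemma k5_le: "k5 r p\<^sub>0 p\<^sub>1 p\<^sub>2 h \<le> 6"
  by (cases r; cases p\<^sub>0; cases p\<^sub>1; cases p\<^sub>2; cases h; simp add: k5_def)

lemma k5_eq_le: "k5 r r r r h \<le> 4"
  by (cases r; cases h; simp add: k5_def)

text \<open>The other four vertices are split 1:3 or 2:2, and the free vertex can complete either to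
  2:3.\<close>

lemma k5_max: "\<not> (p\<^sub>0 = r \<and> p\<^sub>1 = r \<and> p\<^sub>2 = r) \<Longrightarrow> \<exists>h. k5 r p\<^sub>0 p\<^sub>1 p\<^sub>2 h = 6"
  by (cases r; cases p\<^sub>0; cases p\<^sub>1; cases p\<^sub>2; simp add: k5_def ex_bool_eq)

lemma link_le: "link x b p q \<le> 2"
  by (simp add: link_def)

text \<open>For a positive literal the number of cut edges on the path has the parity of
  \<open>x \<noteq> p\<close>, hence is odd here; for a negative one the edge from variable to port
  is uncut.\<close>

lemma link_wrong_le: "p \<noteq> (x = b) \<Longrightarrow> link x b p q \<le> 1"
  by (cases x; cases b; cases p; cases q; simp add: link_def)

lemma link_eq: "link x b (x = b) (x \<noteq> b) = 2"
  by (cases x; cases b; simp add: link_def)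

lemma link_wrong_eq: "link x b (x \<noteq> b) (x = b) = 1"
  by (cases x; cases b; simp add: link_def)

lemma cut_value_gadget:
  assumes "pad_clause n c = [(x\<^sub>0, b\<^sub>0), (x\<^sub>1, b\<^sub>1), (x\<^sub>2, b\<^sub>2)]"
  shows "cut_value (gadget n b c) a = k5 (a n) (a b) (a (b + 2)) (a (b + 4)) (a (b + 6)) +
     link (a x\<^sub>0) b\<^sub>0 (a b) (a (b + 1)) + link (a x\<^sub>1) b\<^sub>1 (a (b + 2)) (a (b + 3)) +
     link (a x\<^sub>2) b\<^sub>2 (a (b + 4)) (a (b + 5))"
proof -
  have e: "a (b + of_bool b\<^sub>0) = (if b\<^sub>0 then a (b + 1) else a b)"
    "a (b + 2 + of_bool b\<^sub>1) = (if b\<^sub>1 then a (b + 3) else a (b + 2))"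
    "a (b + 4 + of_bool b\<^sub>2) = (if b\<^sub>2 then a (b + 5) else a (b + 4))"
    by (simp_all add: eval_nat_numeral)
  show ?thesis
    unfolding gadget_padded[OF assms] cut_value_Cons cut_value_Nil e k5_def link_def
    by (simp only: add_ac add_0_right add_0_left)
qed

text \<open>\<open>a x = b\<close> is the side on which the port of the literal
  \<open>(x, b)\<close> should lie. Truth is measured relative to the side of \<open>n\<close>, so
  exchanging the two sides of a cut does not matter.\<close>

lemma falsified_padded:
  assumes "length c \<le> 3" "pad_clause n c = [(x\<^sub>0, b\<^sub>0), (x\<^sub>1, b\<^sub>1), (x\<^sub>2, b\<^sub>2)]"
  shows "falsified (\<lambda>x. a x \<noteq> a n) c \<longleftrightarrow>
    (a x\<^sub>0 = b\<^sub>0) = a n \<and> (a x\<^sub>1 = b\<^sub>1) = a n \<and> (a x\<^sub>2 = b\<^sub>2) = a n"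
proof -
  have "falsified (\<lambda>x. a x \<noteq> a n) c \<longleftrightarrow> falsified (\<lambda>x. a x \<noteq> a n) (pad_clause n c)"
    using assms(1) by (simp add: falsified_pad_clause)
  then show ?thesis
    by (auto simp: assms(2) falsified_def)
qed

lemma cut_value_gadget_le:
  assumes "length c \<le> 3"
  shows "cut_value (gadget n b c) a + of_bool (falsified (\<lambda>x. a x \<noteq> a n) c) \<le> 12"
proof -
  obtain x\<^sub>0 b\<^sub>0 x\<^sub>1 b\<^sub>1 x\<^sub>2 b\<^sub>2 where c: "pad_clause n c = [(x\<^sub>0, b\<^sub>0), (x\<^sub>1, b\<^sub>1), (x\<^sub>2, b\<^sub>2)]"
    by (rule pad_clause_cases)
  note le = k5_le[of "a n" "a b" "a (b + 2)" "a (b + 4)" "a (b + 6)"]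
    link_le[of "a x\<^sub>0" b\<^sub>0 "a b" "a (b + 1)"] link_le[of "a x\<^sub>1" b\<^sub>1 "a (b + 2)" "a (b + 3)"]
    link_le[of "a x\<^sub>2" b\<^sub>2 "a (b + 4)" "a (b + 5)"]
  show ?thesis
  proof (cases "falsified (\<lambda>x. a x \<noteq> a n) c")
    case False
    then show ?thesis
      using le unfolding cut_value_gadget[OF c] by simp
  next
    case True
    then have f: "(a x\<^sub>0 = b\<^sub>0) = a n" "(a x\<^sub>1 = b\<^sub>1) = a n" "(a x\<^sub>2 = b\<^sub>2) = a n"
      using falsified_padded[OF assms c, of a] by auto
    \<comment> \<open>By \<open>f\<close> all ports should lie on the side of \<open>n\<close>. If
      they do, the \<open>k5\<close> part loses two edges; a port that does not has a link losing
      one.\<close>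
    consider "a b = a n \<and> a (b + 2) = a n \<and> a (b + 4) = a n" | "a b \<noteq> a n" |
      "a (b + 2) \<noteq> a n" | "a (b + 4) \<noteq> a n"
      by auto
    then have "cut_value (gadget n b c) a \<le> 11"
    proof cases
      case 1
      then have "k5 (a n) (a b) (a (b + 2)) (a (b + 4)) (a (b + 6)) \<le> 4"
        using k5_eq_le[of "a n"] by simp
      then show ?thesis
        using le unfolding cut_value_gadget[OF c] by linarith
    next
      case 2
      then have "link (a x\<^sub>0) b\<^sub>0 (a b) (a (b + 1)) \<le> 1"
        using f by (intro link_wrong_le) simp
      then show ?thesis
        using le unfolding cut_value_gadget[OF c] by linarith
    next
      case 3
      then have "link (a x\<^sub>1) b\<^sub>1 (a (b + 2)) (a (b + 3)) \<le> 1"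
        using f by (intro link_wrong_le) simp
      then show ?thesis
        using le unfolding cut_value_gadget[OF c] by linarith
    next
      case 4
      then have "link (a x\<^sub>2) b\<^sub>2 (a (b + 4)) (a (b + 5)) \<le> 1"
        using f by (intro link_wrong_le) simp
      then show ?thesis
        using le unfolding cut_value_gadget[OF c] by linarith
    qed
    then show ?thesis
      by simp
  qed
qed

text \<open>The sides of all vertices below \<open>b\<close> are kept, so that the blocks can be
  filled one after another.\<close>

lemma cut_value_gadget_attained:
  assumes "length c \<le> 3" "fst ` set c \<subseteq> {..<n}" "n < b"
  obtains a' where "\<And>v. v < b \<Longrightarrow> a' v = a v"
    "cut_value (gadget n b c) a' + of_bool (falsified (\<lambda>x. a x \<noteq> a n) c) = 12"
proof -
  obtain x\<^sub>0 b\<^sub>0 x\<^sub>1 b\<^sub>1 x\<^sub>2 b\<^sub>2 where c: "pad_clause n c = [(x\<^sub>0, b\<^sub>0), (x\<^sub>1, b\<^sub>1), (x\<^sub>2, b\<^sub>2)]"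
    by (rule pad_clause_cases)
  then have "\<forall>x\<in>{x\<^sub>0, x\<^sub>1, x\<^sub>2}. x \<in> insert n (fst ` set c)"
    using pad_clause_subset[OF assms(1), of n] by force
  then have x: "x\<^sub>0 < b" "x\<^sub>1 < b" "x\<^sub>2 < b"
    using assms(2,3) by force+
  \<comment> \<open>The second and third link are always optimal, which accounts for the 4 below.
    The first stays open: it is the one sacrificed to balance the \<open>k5\<close> part when the
    clause is falsified.\<close>
  define a' where "a' p\<^sub>0 q\<^sub>0 h = a(b := p\<^sub>0, b + 1 := q\<^sub>0, b + 2 := (a x\<^sub>1 = b\<^sub>1), b + 3 := (a x\<^sub>1 \<noteq> b\<^sub>1),
    b + 4 := (a x\<^sub>2 = b\<^sub>2), b + 5 := (a x\<^sub>2 \<noteq> b\<^sub>2), b + 6 := h)" for p\<^sub>0 q\<^sub>0 h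
  have val: "cut_value (gadget n b c) (a' p\<^sub>0 q\<^sub>0 h) =
    k5 (a n) p\<^sub>0 (a x\<^sub>1 = b\<^sub>1) (a x\<^sub>2 = b\<^sub>2) h + link (a x\<^sub>0) b\<^sub>0 p\<^sub>0 q\<^sub>0 + 4" for p\<^sub>0 q\<^sub>0 h
    unfolding cut_value_gadget[OF c] using x assms(3) by (simp add: a'_def link_eq[simplified])
  show ?thesis
  proof (cases "falsified (\<lambda>x. a x \<noteq> a n) c")
    case True
    then have f: "(a x\<^sub>0 = b\<^sub>0) = a n" "(a x\<^sub>1 = b\<^sub>1) = a n" "(a x\<^sub>2 = b\<^sub>2) = a n"
      using falsified_padded[OF assms(1) c, of a] by auto
    obtain h where "k5 (a n) (a x\<^sub>0 \<noteq> b\<^sub>0) (a x\<^sub>1 = b\<^sub>1) (a x\<^sub>2 = b\<^sub>2) h = 6"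
      using k5_max[of "a x\<^sub>0 \<noteq> b\<^sub>0" "a n" "a x\<^sub>1 = b\<^sub>1" "a x\<^sub>2 = b\<^sub>2"] f by blast
    then have "cut_value (gadget n b c) (a' (a x\<^sub>0 \<noteq> b\<^sub>0) (a x\<^sub>0 = b\<^sub>0) h) = 11"
      unfolding val link_wrong_eq by simp
    then show ?thesis
      using True by (intro that[of "a' (a x\<^sub>0 \<noteq> b\<^sub>0) (a x\<^sub>0 = b\<^sub>0) h"]) (simp_all add: a'_def)
  next
    case False
    then obtain h where "k5 (a n) (a x\<^sub>0 = b\<^sub>0) (a x\<^sub>1 = b\<^sub>1) (a x\<^sub>2 = b\<^sub>2) h = 6"
      using k5_max[of "a x\<^sub>0 = b\<^sub>0" "a n" "a x\<^sub>1 = b\<^sub>1" "a x\<^sub>2 = b\<^sub>2"]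
        falsified_padded[OF assms(1) c, of a] by blast
    then have "cut_value (gadget n b c) (a' (a x\<^sub>0 = b\<^sub>0) (a x\<^sub>0 \<noteq> b\<^sub>0) h) = 12"
      unfolding val link_eq by simp
    then show ?thesis
      using False by (intro that[of "a' (a x\<^sub>0 = b\<^sub>0) (a x\<^sub>0 \<noteq> b\<^sub>0) h"]) (simp_all add: a'_def)
  qed
qed

section \<open>Position and distinctness of the edges, and cuts of the whole graph\<close>

lemma gadget_edge_bounds:
  assumes "length c \<le> 3" "fst ` set c \<subseteq> {..<n}" "n < b" "(u, v) \<in> set (gadget n b c)"
  shows "u < v" "b \<le> v" "v < b + 7"
    "u \<le> n \<and> u \<in> insert n (fst ` set c) \<or> b \<le> u"
proof -
  obtain x\<^sub>0 b\<^sub>0 x\<^sub>1 b\<^sub>1 x\<^sub>2 b\<^sub>2 where c: "pad_clause n c = [(x\<^sub>0, b\<^sub>0), (x\<^sub>1, b\<^sub>1), (x\<^sub>2, b\<^sub>2)]"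
    by (rule pad_clause_cases)
  then have x: "\<forall>x\<in>{x\<^sub>0, x\<^sub>1, x\<^sub>2}. x \<in> insert n (fst ` set c)"
    using pad_clause_subset[OF assms(1), of n] by force
  then have x': "\<forall>x\<in>{x\<^sub>0, x\<^sub>1, x\<^sub>2}. x \<le> n"
    using assms(2) by force
  have "(u \<in> {x\<^sub>0, x\<^sub>1, x\<^sub>2, n} \<or> b \<le> u \<and> u < v) \<and> b \<le> v \<and> v < b + 7"
    using assms(4) unfolding gadget_padded[OF c] list.set insert_iff empty_iff prod.inject
    by (elim disjE conjE) (simp_all add: of_bool_def)
  then show "u < v" "b \<le> v" "v < b + 7" "u \<le> n \<and> u \<in> insert n (fst ` set c) \<or> b \<le> u"
    using x x' assms(3) by auto
qed

text \<open>A literal edge could coincide only with an edge from \<open>n\<close> to a port, for a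
  negative literal on \<open>n\<close>. Clause variables are below \<open>n\<close>, and the padding
  literal is positive, so it leads to an inner vertex instead.\<close>

lemma distinct_gadget:
  assumes "length c \<le> 3" "fst ` set c \<subseteq> {..<n}" "n < b"
  shows "distinct (gadget n b c)"
proof -
  obtain x\<^sub>0 b\<^sub>0 x\<^sub>1 b\<^sub>1 x\<^sub>2 b\<^sub>2 where c: "pad_clause n c = [(x\<^sub>0, b\<^sub>0), (x\<^sub>1, b\<^sub>1), (x\<^sub>2, b\<^sub>2)]"
    by (rule pad_clause_cases)
  then have "\<forall>(x, d)\<in>{(x\<^sub>0, b\<^sub>0), (x\<^sub>1, b\<^sub>1), (x\<^sub>2, b\<^sub>2)}. (x, d) \<in> insert (n, True) (set c)"
    using pad_clause_subset[OF assms(1), of n] by force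
  then have "x\<^sub>0 < b" "x\<^sub>1 < b" "x\<^sub>2 < b"
    "\<not> b\<^sub>0 \<Longrightarrow> x\<^sub>0 \<noteq> n" "\<not> b\<^sub>1 \<Longrightarrow> x\<^sub>1 \<noteq> n" "\<not> b\<^sub>2 \<Longrightarrow> x\<^sub>2 \<noteq> n"
    using assms(2,3) by force+
  then show ?thesis
    using assms(3) unfolding gadget_padded[OF c] by (cases b\<^sub>0; cases b\<^sub>1; cases b\<^sub>2; simp)
qed

definition nfalsified :: "(nat \<Rightarrow> bool) \<Rightarrow> literal list list \<Rightarrow> nat" where
  "nfalsified \<alpha> cs = length (filter (falsified \<alpha>) cs)"

lemma nfalsified_simps [simp]:
  "nfalsified \<alpha> [] = 0"
  "nfalsified \<alpha> (c # cs) = of_bool (falsified \<alpha> c) + nfalsified \<alpha> cs"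
  by (simp_all add: nfalsified_def)

lemma cut_value_graph_le:
  assumes "\<forall>c\<in>set cs. length c \<le> 3"
  shows "cut_value (graph_edges n b cs) a + nfalsified (\<lambda>x. a x \<noteq> a n) cs \<le> 12 * length cs"
  using assms
proof (induction cs arbitrary: b)
  case (Cons c cs)
  have "cut_value (gadget n b c) a + of_bool (falsified (\<lambda>x. a x \<noteq> a n) c) \<le> 12"
    using Cons.prems by (intro cut_value_gadget_le) simp
  moreover have "cut_value (graph_edges n (b + 7) cs) a + nfalsified (\<lambda>x. a x \<noteq> a n) cs \<le> 12 * length cs"
    using Cons.prems by (intro Cons.IH) simp
  moreover have "p + k \<le> 12 \<Longrightarrow> q + l \<le> 12 * m \<Longrightarrow> p + q + (k + l) \<le> 12 * (m + Suc 0)" for p q k l m :: nat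
    by simp
  ultimately show ?case
    unfolding graph_edges.simps cut_value_append nfalsified_simps list.size by blast
qed simp

lemma cut_value_cong:
  "(\<And>u v. (u, v) \<in> set es \<Longrightarrow> a u = a' u \<and> a v = a' v) \<Longrightarrow> cut_value es a = cut_value es a'"
  unfolding cut_value_def by (intro arg_cong[where f = length] filter_cong) auto

lemma falsified_cong:
  "(\<And>x. x \<in> fst ` set c \<Longrightarrow> \<alpha> x = \<beta> x) \<Longrightarrow> falsified \<alpha> c = falsified \<beta> c"
  unfolding falsified_def by force

lemma nfalsified_cong:
  assumes "\<forall>c\<in>set cs. fst ` set c \<subseteq> {..<n}" "\<And>x. x < n \<Longrightarrow> \<alpha> x = \<beta> x"
  shows "nfalsified \<alpha> cs = nfalsified \<beta> cs"
  unfolding nfalsified_def using assms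
  by (intro arg_cong[where f = length] filter_cong falsified_cong) auto

text \<open>The blocks are filled from left to right, each optimally given the sides of variables
  and reference vertex. Generalizing over \<open>a\<close> lets the induction continue from the
  sides chosen so far.\<close>

lemma cut_value_graph_attained:
  assumes "\<forall>c\<in>set cs. length c \<le> 3 \<and> fst ` set c \<subseteq> {..<n}" "n < b"
  shows "\<exists>a'. (\<forall>v<b. a' v = a v) \<and>
    cut_value (graph_edges n b cs) a' + nfalsified (\<lambda>x. a x \<noteq> a n) cs = 12 * length cs"
  using assms
proof (induction cs arbitrary: b a)
  case (Cons c cs)
  then have c: "length c \<le> 3" "fst ` set c \<subseteq> {..<n}" and cs: "\<forall>c\<in>set cs. fst ` set c \<subseteq> {..<n}"
    by auto
  obtain a\<^sub>1 where a1: "\<And>v. v < b \<Longrightarrow> a\<^sub>1 v = a v"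
    "cut_value (gadget n b c) a\<^sub>1 + of_bool (falsified (\<lambda>x. a x \<noteq> a n) c) = 12"
    using cut_value_gadget_attained[OF c \<open>n < b\<close>, of a] by blast
  obtain a\<^sub>2 where a2: "\<forall>v<b + 7. a\<^sub>2 v = a\<^sub>1 v"
    "cut_value (graph_edges n (b + 7) cs) a\<^sub>2 + nfalsified (\<lambda>x. a\<^sub>1 x \<noteq> a\<^sub>1 n) cs = 12 * length cs"
    using Cons.IH[of "b + 7" a\<^sub>1] Cons.prems by auto
  \<comment> \<open>All ends of edges of this gadget are below \<open>b + 7\<close>, where the later
    choices change nothing.\<close>
  have "cut_value (gadget n b c) a\<^sub>2 = cut_value (gadget n b c) a\<^sub>1"
    using gadget_edge_bounds[OF c \<open>n < b\<close>] a2(1)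
    by (intro cut_value_cong) (meson less_trans)
  moreover have "nfalsified (\<lambda>x. a\<^sub>1 x \<noteq> a\<^sub>1 n) cs = nfalsified (\<lambda>x. a x \<noteq> a n) cs"
    using a1(1) \<open>n < b\<close> by (intro nfalsified_cong[OF cs]) auto
  ultimately show ?case
    using a1 a2 by (intro exI[of _ a\<^sub>2]) auto
qed auto

lemma graph_edge_block:
  assumes "\<forall>c\<in>set cs. length c \<le> 3 \<and> fst ` set c \<subseteq> {..<n}" "n < b"
    "(u, v) \<in> set (graph_edges n b cs)"
  shows "\<exists>i<length cs. (u, v) \<in> set (gadget n (b + 7 * i) (cs ! i))"
  using assms
proof (induction cs arbitrary: b)
  case (Cons c cs)
  from Cons.prems(3) consider "(u, v) \<in> set (gadget n b c)" | "(u, v) \<in> set (graph_edges n (b + 7) cs)"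
    by auto
  then show ?case
  proof cases
    case 2
    then obtain i where "i < length cs" "(u, v) \<in> set (gadget n (b + 7 + 7 * i) (cs ! i))"
      using Cons.IH[of "b + 7"] Cons.prems by auto
    then show ?thesis
      by (intro exI[of _ "Suc i"]) (simp add: ac_simps)
  qed auto
qed simp

lemma graph_edge_bounds:
  assumes "\<forall>c\<in>set cs. length c \<le> 3 \<and> fst ` set c \<subseteq> {..<n}" "n < b"
    "(u, v) \<in> set (graph_edges n b cs)"
  shows "u < v" "b \<le> v" "v < b + 7 * length cs"
proof -
  obtain i where i: "i < length cs" "(u, v) \<in> set (gadget n (b + 7 * i) (cs ! i))"
    using graph_edge_block[OF assms] by blast
  then have c: "length (cs ! i) \<le> 3" "fst ` set (cs ! i) \<subseteq> {..<n}" "n < b + 7 * i"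
    using assms by auto
  note e = gadget_edge_bounds[OF c i(2)]
  show "u < v" "b \<le> v" "v < b + 7 * length cs"
    using e i(1) by linarith+
qed

lemma distinct_graph_edges:
  assumes "\<forall>c\<in>set cs. length c \<le> 3 \<and> fst ` set c \<subseteq> {..<n}" "n < b"
  shows "distinct (graph_edges n b cs)"
  using assms
proof (induction cs arbitrary: b)
  case (Cons c cs)
  then have c: "length c \<le> 3" "fst ` set c \<subseteq> {..<n}"
    and cs: "\<forall>c\<in>set cs. length c \<le> 3 \<and> fst ` set c \<subseteq> {..<n}"
    by auto
  have "(u, v) \<notin> set (graph_edges n (b + 7) cs)" if "(u, v) \<in> set (gadget n b c)" for u v
    using gadget_edge_bounds(3)[OF c \<open>n < b\<close> that] graph_edge_bounds(2)[OF cs, of "b + 7" u v] \<open>n < b\<close>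
    by linarith
  then have "set (gadget n b c) \<inter> set (graph_edges n (b + 7) cs) = {}"
    by auto
  then show ?case
    using distinct_gadget[OF c \<open>n < b\<close>] Cons.IH[OF cs, of "b + 7"] \<open>n < b\<close> by simp
qed simp

lemma length_graph_edges: "length (graph_edges n b cs) = 16 * length cs"
  by (induction cs arbitrary: b) (simp_all add: gadget_def)

lemma inj_on_ordered_pair:
  assumes "\<And>u v. (u, v) \<in> S \<Longrightarrow> u < v"
  shows "inj_on (\<lambda>(u, v). {u, v :: nat}) S"
proof (rule inj_onI)
  fix p q
  assume pq: "p \<in> S" "q \<in> S" "(\<lambda>(u, v). {u, v}) p = (\<lambda>(u, v). {u, v}) q"
  obtain u v x y where uv: "p = (u, v)" "q = (x, y)"
    by (cases p; cases q)
  then have "u < v" "x < y"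
    using assms pq(1,2) by auto
  then show "p = q"
    using pq(3) uv by (auto simp: doubleton_eq_iff)
qed

text \<open>Pairs with increasing entries represent unordered edges injectively, so a duplicate-free
  list counts every cut edge once.\<close>

lemma card_cut_edges:
  assumes "distinct es" "\<And>u v. (u, v) \<in> set es \<Longrightarrow> u < v \<and> v < N"
  shows "card (cut_edges {..<N} ((\<lambda>(u, v). {u, v}) ` set es) A) = cut_value es (\<lambda>v. v \<in> A)"
proof -
  have "cut_edges {..<N} ((\<lambda>(u, v). {u, v}) ` set es) A =
    (\<lambda>(u, v). {u, v}) ` {(u, v) \<in> set es. (u \<in> A) \<noteq> (v \<in> A)}" (is "?L = ?R")
  proof (intro equalityI subsetI)
    fix e assume "e \<in> ?L"
    then obtain u v x y where uv: "(u, v) \<in> set es" "e = {u, v}" "e = {x, y}" "x \<in> A" "y \<notin> A"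
      by (auto simp: cut_edges_def)
    then have "(u \<in> A) \<noteq> (v \<in> A)"
      by (auto simp: doubleton_eq_iff)
    then show "e \<in> ?R"
      using uv(1,2) by (intro image_eqI[of _ _ "(u, v)"]) auto
  next
    fix e assume "e \<in> ?R"
    then obtain u v where uv: "(u, v) \<in> set es" "e = {u, v}" "(u \<in> A) \<noteq> (v \<in> A)"
      by auto
    then have "u < N" "v < N"
      using assms(2)[of u v] by auto
    then have "\<exists>x\<in>A. \<exists>y\<in>{..<N} - A. e = {x, y}"
      using uv(2,3) by (cases "u \<in> A") auto
    moreover have "e \<in> (\<lambda>(u, v). {u, v}) ` set es"
      using uv(1,2) by (intro image_eqI[of _ _ "(u, v)"]) auto
    ultimately show "e \<in> ?L"
      unfolding cut_edges_def by blast
  qed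
  moreover have "inj_on (\<lambda>(u, v). {u, v}) {(u, v) \<in> set es. (u \<in> A) \<noteq> (v \<in> A)}"
    using assms(2) by (intro inj_on_ordered_pair) auto
  moreover have "card {(u, v) \<in> set es. (u \<in> A) \<noteq> (v \<in> A)} = cut_value es (\<lambda>v. v \<in> A)"
  proof -
    have "{(u, v) \<in> set es. (u \<in> A) \<noteq> (v \<in> A)} = set (filter (\<lambda>(u, v). (u \<in> A) \<noteq> (v \<in> A)) es)"
      by auto
    then show ?thesis
      using assms(1) distinct_card[of "filter (\<lambda>(u, v). (u \<in> A) \<noteq> (v \<in> A)) es"]
      by (simp add: cut_value_def)
  qed
  ultimately show ?thesis
    by (simp add: card_image)
qed

lemma card_violated:
  assumes "cnf_listing cs F"
  shows "card (violated F \<alpha>) = nfalsified \<alpha> cs"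
proof -
  have d: "distinct (map set cs)" "F = set ` set cs"
    using assms by (auto simp: cnf_listing_def)
  have "violated F \<alpha> = set ` set (filter (falsified \<alpha>) cs)"
    by (auto simp: violated_def d(2) falsified_def)
  moreover have "inj_on set (set (filter (falsified \<alpha>) cs))"
    using d(1) by (auto simp: distinct_map intro: inj_on_subset)
  moreover have "distinct (filter (falsified \<alpha>) cs)"
    using d(1) by (simp add: distinct_map)
  ultimately show ?thesis
    using distinct_card[of "filter (falsified \<alpha>) cs"] by (simp add: card_image nfalsified_def)
qed

definition cnf_graph :: "nat \<Rightarrow> literal list list \<Rightarrow> nat set set" where
  "cnf_graph n cs = (\<lambda>(u, v). {u, v}) ` set (graph_edges n (Suc n) cs)"

section \<open>Hub and maximum cuts of the graph of a fixed formula\<close>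

context
  fixes n :: nat and F :: "clause set" and cs :: "literal list list"
  assumes F: "three_cnf n F" and listing: "cnf_listing cs F"
begin

lemma clause_bounds: "\<forall>c\<in>set cs. length c \<le> 3 \<and> fst ` set c \<subseteq> {..<n}"
proof
  fix c assume c: "c \<in> set cs"
  then have "set c \<in> F" "distinct c"
    using listing by (auto simp: cnf_listing_def)
  then show "length c \<le> 3 \<and> fst ` set c \<subseteq> {..<n}"
    using F by (auto simp: three_cnf_def distinct_card)
qed

lemma edge_bounds:
  assumes "(u, v) \<in> set (graph_edges n (Suc n) cs)"
  shows "u < v" "n < v" "v < Suc n + 7 * length cs"
  using graph_edge_bounds[OF clause_bounds _ assms] by auto

lemma edge_listing_cnf_graph: "edge_listing (graph_edges n (Suc n) cs) (cnf_graph n cs)"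
  using distinct_graph_edges[OF clause_bounds, of "Suc n"] edge_bounds(1)
  by (auto simp: edge_listing_def cnf_graph_def distinct_map intro!: inj_on_ordered_pair)

lemma simple_cnf_graph: "simple_graph {..<Suc n + 7 * length cs} (cnf_graph n cs)"
  unfolding simple_graph_def
proof (intro conjI ballI)
  fix e assume "e \<in> cnf_graph n cs"
  then obtain u v where e: "e = {u, v}" "(u, v) \<in> set (graph_edges n (Suc n) cs)"
    by (auto simp: cnf_graph_def)
  have "u < v" "v < Suc n + 7 * length cs"
    using edge_bounds[OF e(2)] by auto
  then show "e \<subseteq> {..<Suc n + 7 * length cs}" "card e = 2"
    using e(1) by auto
qed simp

text \<open>\<open>(y - Suc n) div 7\<close> is the index of the block, and thus of the clause, to
  which a vertex outside the hub belongs.\<close>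

lemma cnf_graph_edge_block:
  assumes "{x, y} \<in> cnf_graph n cs" "n < y"
  shows "(y - Suc n) div 7 < length cs"
    "n < x \<Longrightarrow> (x - Suc n) div 7 = (y - Suc n) div 7"
    "x \<le> n \<Longrightarrow> x \<in> insert n (fst ` set (cs ! ((y - Suc n) div 7)))"
proof -
  obtain u v where uv: "(u, v) \<in> set (graph_edges n (Suc n) cs)" "{x, y} = {u, v}"
    using assms(1) by (auto simp: cnf_graph_def)
  obtain i where i: "i < length cs" "(u, v) \<in> set (gadget n (Suc n + 7 * i) (cs ! i))"
    using graph_edge_block[OF clause_bounds _ uv(1)] by auto
  then have c: "length (cs ! i) \<le> 3" "fst ` set (cs ! i) \<subseteq> {..<n}" "n < Suc n + 7 * i"
    using clause_bounds by auto
  note e = gadget_edge_bounds[OF c i(2)]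
  have blk: "(z - Suc n) div 7 = i" if "Suc n + 7 * i \<le> z" "z < Suc n + 7 * i + 7" for z
    using that by (intro div_nat_eqI) auto
  have v: "(v - Suc n) div 7 = i"
    using e by (intro blk)
  have u: "(u - Suc n) div 7 = i" if "n < u"
    using e that by (intro blk) auto
  have y: "(y - Suc n) div 7 = i"
    using uv(2) u v assms(2) by (auto simp: doubleton_eq_iff)
  show "(y - Suc n) div 7 < length cs"
    using y i by simp
  show "(x - Suc n) div 7 = (y - Suc n) div 7" if "n < x"
    using y uv(2) u v that by (auto simp: doubleton_eq_iff)
  show "x \<in> insert n (fst ` set (cs ! ((y - Suc n) div 7)))" if "x \<le> n"
  proof -
    have "x = u"
      using uv(2) that e(2) by (auto simp: doubleton_eq_iff)
    then show ?thesis
      using y e(4) that by auto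
  qed
qed

lemma hub_cnf_graph: "hub 7 4 {..<Suc n + 7 * length cs} (cnf_graph n cs) {..<Suc n}"
  unfolding hub_def
proof (intro conjI ballI)
  let ?V = "{..<Suc n + 7 * length cs} - {..<Suc n}"
  let ?R = "{(x, y). x \<in> ?V \<and> y \<in> ?V \<and> {x, y} \<in> cnf_graph n cs}"
  fix C assume "C \<in> components ?V (cnf_graph n cs)"
  then obtain w where w: "w \<in> ?V" "C = ?R\<^sup>* `` {w}"
    by (auto simp: components_def)
  define i where "i = (w - Suc n) div 7"
  have i: "i < length cs"
    using w(1) by (auto simp: i_def)
  \<comment> \<open>No edge outside the hub joins two blocks, so the block index is constant along
    paths. The neighbours of the component in the hub are then \<open>n\<close> and the variables of
    one clause.\<close>
  have blk: "n < z \<and> (z - Suc n) div 7 = i" if "z \<in> C" for z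
  proof -
    have "(w, z) \<in> ?R\<^sup>*"
      using that w(2) by auto
    then show ?thesis
    proof (induction rule: rtrancl_induct)
      case base
      then show ?case
        using w(1) by (auto simp: i_def)
    next
      case (step y z)
      then show ?case
        using cnf_graph_edge_block(2)[of y z] by auto
    qed
  qed
  have "C \<subseteq> {Suc n + 7 * i..<Suc n + 7 * i + 7}"
  proof
    fix z assume "z \<in> C"
    then have "n < z" "(z - Suc n) div 7 = i"
      using blk by auto
    then show "z \<in> {Suc n + 7 * i..<Suc n + 7 * i + 7}"
      by auto
  qed
  then show "card C \<le> 7"
    using card_mono[of "{Suc n + 7 * i..<Suc n + 7 * i + 7}" C] by simp
  have "{q \<in> {..<Suc n}. \<exists>v\<in>C. {q, v} \<in> cnf_graph n cs} \<subseteq> insert n (fst ` set (cs ! i))"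
    using cnf_graph_edge_block(3) blk by fastforce
  then have "card {q \<in> {..<Suc n}. \<exists>v\<in>C. {q, v} \<in> cnf_graph n cs} \<le> card (insert n (fst ` set (cs ! i)))"
    by (intro card_mono) auto
  also have "\<dots> \<le> Suc (card (fst ` set (cs ! i)))"
    by (rule card_insert_le_m1) auto
  also have "card (fst ` set (cs ! i)) \<le> length (cs ! i)"
    by (meson card_image_le card_length finite_set le_trans)
  also have "length (cs ! i) \<le> 3"
    using clause_bounds i by auto
  finally show "card {q \<in> {..<Suc n}. \<exists>v\<in>C. {q, v} \<in> cnf_graph n cs} \<le> 4"
    by simp
qed auto

text \<open>Let \<open>m\<close> be the number of clauses. The cut built from \<beta> has
  \<open>12 * m\<close> minus the falsified clauses of \<beta>, the cut \<open>A\<close> at most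
  \<open>12 * m\<close> minus those of \<alpha>, and \<open>A\<close> is maximum.\<close>

lemma max_cut_imp_optimal:
  assumes A: "is_max_cut {..<Suc n + 7 * length cs} (cnf_graph n cs) A"
    and \<alpha>: "\<And>x. x < n \<Longrightarrow> \<alpha> x \<longleftrightarrow> (x \<in> A) \<noteq> (n \<in> A)"
  shows "max_sat_optimal F \<alpha>"
  unfolding max_sat_optimal_def
proof
  fix \<beta>
  let ?es = "graph_edges n (Suc n) cs" and ?N = "Suc n + 7 * length cs"
  have card: "card (cut_edges {..<?N} (cnf_graph n cs) B) = cut_value ?es (\<lambda>v. v \<in> B)" for B
    unfolding cnf_graph_def
  proof (rule card_cut_edges)
    show "distinct ?es"
      using clause_bounds by (rule distinct_graph_edges) simp
    show "u < v \<and> v < ?N" if "(u, v) \<in> set ?es" for u v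
      using edge_bounds[OF that] by simp
  qed
  have vars: "\<forall>c\<in>set cs. fst ` set c \<subseteq> {..<n}"
    using clause_bounds by auto
  \<comment> \<open>Forcing the value False at \<open>n\<close> makes sides and truth values of the
    variables coincide.\<close>
  let ?\<beta> = "\<lambda>x. x \<noteq> n \<and> \<beta> x"
  obtain a where a: "\<forall>v<Suc n. a v = ?\<beta> v"
    "cut_value ?es a + nfalsified (\<lambda>x. ?\<beta> x \<noteq> ?\<beta> n) cs = 12 * length cs"
    using cut_value_graph_attained[OF clause_bounds, of "Suc n" ?\<beta>] by auto
  have "cut_value ?es a = cut_value ?es (\<lambda>v. v \<in> {v. v < ?N \<and> a v})"
  proof (rule cut_value_cong)
    fix u v assume "(u, v) \<in> set ?es"
    then show "a u = (u \<in> {v. v < ?N \<and> a v}) \<and> a v = (v \<in> {v. v < ?N \<and> a v})"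
      using edge_bounds[of u v] by simp
  qed
  also have "\<dots> \<le> cut_value ?es (\<lambda>v. v \<in> A)"
  proof -
    have "card (cut_edges {..<?N} (cnf_graph n cs) {v. v < ?N \<and> a v}) \<le>
        card (cut_edges {..<?N} (cnf_graph n cs) A)"
      using A unfolding is_max_cut_def by (metis (no_types, lifting) lessThan_iff mem_Collect_eq subsetI)
    then show ?thesis
      by (simp only: card)
  qed
  finally have "cut_value ?es a \<le> cut_value ?es (\<lambda>v. v \<in> A)" .
  moreover have "cut_value ?es (\<lambda>v. v \<in> A) + nfalsified (\<lambda>x. (x \<in> A) \<noteq> (n \<in> A)) cs \<le> 12 * length cs"
    using clause_bounds by (intro cut_value_graph_le) auto
  moreover have "nfalsified (\<lambda>x. (x \<in> A) \<noteq> (n \<in> A)) cs = nfalsified \<alpha> cs"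
    using \<alpha> by (intro nfalsified_cong[OF vars]) auto
  moreover have "nfalsified (\<lambda>x. ?\<beta> x \<noteq> ?\<beta> n) cs = nfalsified \<beta> cs"
    by (intro nfalsified_cong[OF vars]) auto
  ultimately show "card (violated F \<alpha>) \<le> card (violated F \<beta>)"
    using a(2) unfolding card_violated[OF listing] by linarith
qed

text \<open>Clauses are pairwise different as sets, and there are only polynomially many lists of at
  most three of the \<open>2 * n\<close> literals. Hence bounds polynomial in \<open>n\<close> and
  the number of clauses are polynomial in \<open>n\<close> alone.\<close>

lemma length_cnf_le: "length cs \<le> 4 * (2 * n + 1) ^ 3"
proof -
  let ?A = "{..<n} \<times> (UNIV :: bool set)"
  have "length cs = card (set ` set cs)"
    using listing distinct_card[of "map set cs"] by (simp add: cnf_listing_def)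
  also have "\<dots> \<le> card (set cs)"
    by (rule card_image_le) simp
  also have "\<dots> \<le> card {c. set c \<subseteq> ?A \<and> length c \<le> 3}"
  proof (intro card_mono finite_lists_length_le)
    show "set cs \<subseteq> {c. set c \<subseteq> ?A \<and> length c \<le> 3}"
      using clause_bounds by fastforce
  qed simp
  also have "\<dots> = (\<Sum>i\<le>3. (2 * n) ^ i)"
    by (subst card_lists_length_le) (auto simp: card_cartesian_product mult.commute)
  \<comment> \<open>The base \<open>2 * n + 1\<close> is at least 1 even for \<open>n = 0\<close>,
    so its powers are monotone in the exponent.\<close>
  also have "\<dots> \<le> (\<Sum>i\<le>(3::nat). (2 * n + 1) ^ 3)"
  proof (rule sum_mono)
    fix i :: nat assume "i \<in> {..3}"
    then show "(2 * n) ^ i \<le> (2 * n + 1) ^ 3"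
      using power_mono[of "2 * n" "2 * n + 1" i] power_increasing[of i 3 "2 * n + 1"] by simp
  qed
  finally show ?thesis
    by simp
qed

end

section \<open>Computing the graph\<close>

definition array_of :: "nat list \<Rightarrow> nat \<Rightarrow> nat" where
  "array_of w i = (if i < length w then w ! i else 0)"

lemma array_of_Cons_0 [simp]: "array_of (x # w) 0 = x"
  by (simp add: array_of_def)

lemma array_of_Cons_Suc [simp]: "array_of (x # w) (Suc i) = array_of w i"
  by (simp add: array_of_def)

lemma array_of_append [simp]:
  "length v \<le> i \<Longrightarrow> array_of (v @ w) i = array_of w (i - length v)"
  by (auto simp: array_of_def nth_append)

lemma array_of_snoc: "(array_of w)(length w := k) = array_of (w @ [k])"
  by (auto simp: array_of_def nth_append fun_eq_iff)

text \<open>The header is filled in after the edges, when the numbers of vertices and edges have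
  been computed.\<close>

lemma array_of_header: "(array_of (x # y # z # w))(0 := x', 1 := y', 2 := z') = array_of (x' # y' # z' # w)"
  by (auto simp: array_of_def fun_eq_iff nth_Cons split: nat.splits)

text \<open>
  The simulated program is shifted by 20, so its input is array 20 and its output is array 21.
\<close>

abbreviation (input) "rT \<equiv> 0 :: nat"
abbreviation (input) "rN \<equiv> 1 :: nat"
abbreviation (input) "rM \<equiv> 2 :: nat"
abbreviation (input) "rIn \<equiv> 3 :: nat"
abbreviation (input) "rOut \<equiv> 4 :: nat"
abbreviation (input) "rBase \<equiv> 5 :: nat"
abbreviation (input) "rOne \<equiv> 6 :: nat"
abbreviation (input) "rLen \<equiv> 7 :: nat"
abbreviation (input) "rEdges \<equiv> 8 :: nat"
abbreviation (input) "rRef \<equiv> 9 :: nat"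
abbreviation (input) "rVar j \<equiv> 10 + j :: nat"
abbreviation (input) "rPort j \<equiv> 14 + j :: nat"

section \<open>The code of the reduction\<close>

primrec seq :: "com list \<Rightarrow> com" where
  "seq [] = Skip"
| "seq (P # Ps) = Seq P (seq Ps)"

lemma loop_free_seq: "loop_free (seq Ps) \<longleftrightarrow> list_all loop_free Ps"
  by (induction Ps) auto

definition emit :: "nat \<times> nat \<Rightarrow> com" where
  "emit = (\<lambda>(r, k). seq [Const rT k, Add rT r rT, Store 20 rOut rT, Add rOut rOut rOne])"

text \<open>The port register receives the base plus the polarity bit; the offset of the port within
  the block is added by \<open>gadget_code\<close>. In the second branch \<open>rLen\<close> is 0,
  so adding it copies \<open>rN\<close>, and \<open>rOne\<close> is the polarity of the padding
  literal.\<close>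

definition read_literal :: "nat \<Rightarrow> com" where
  "read_literal j = Cond rLen
     (seq [Load (rVar j) 0 rIn, Add rIn rIn rOne, Load (rPort j) 0 rIn, Add rIn rIn rOne,
        Add (rPort j) rBase (rPort j), Sub rLen rLen rOne])
     (seq [Add (rVar j) rN rLen, Add (rPort j) rBase rOne])"

definition gadget_code :: "(nat \<times> nat) list" where
  "gadget_code =
     [(rVar 0, 0), (rPort 0, 0), (rVar 1, 0), (rPort 1, 2), (rVar 2, 0), (rPort 2, 4),
      (rBase, 0), (rBase, 1), (rBase, 2), (rBase, 3), (rBase, 4), (rBase, 5),
      (rN, 0), (rBase, 0), (rN, 0), (rBase, 2), (rN, 0), (rBase, 4), (rN, 0), (rBase, 6),
      (rBase, 0), (rBase, 2), (rBase, 0), (rBase, 4), (rBase, 0), (rBase, 6),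
      (rBase, 2), (rBase, 4), (rBase, 2), (rBase, 6), (rBase, 4), (rBase, 6)]"

definition clause_body :: com where
  "clause_body = seq
     [seq [Load rLen 0 rIn, Add rIn rIn rOne, read_literal 0, read_literal 1, read_literal 2],
      seq (map emit gadget_code),
      seq [Const rT 7, Add rBase rBase rT, Const rT 16, Add rEdges rEdges rT, Sub rM rM rOne]]"

definition hub_body :: com where
  "hub_body = seq [Sub rIn rIn rOne, emit (rIn, 0)]"

text \<open>An exclusive or with the side of the reference vertex, up to which nonzero number
  represents true.\<close>

definition answer_body :: com where
  "answer_body = seq [Sub rN rN rOne, Load rT 21 rN,
     Cond rRef (Cond rT (Const rT 0) (Const rT 1)) Skip, Store 1 rN rT]"

text \<open>Reading starts behind the two header entries of the formula; writing starts at 3 to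
  leave room for the header of the graph.\<close>

definition read_header :: com where
  "read_header = seq [Const rOne 1, Const rT 0, Load rN 0 rT, Load rM 0 rOne, Const rIn 2,
     Add rBase rN rOne, Const rOut 3]"

text \<open>After the clause loop \<open>rBase\<close> is the number of vertices. \<open>rIn\<close>
  becomes the hub size \<open>n + 1\<close>, which is written to the header and then counts down in
  the loop listing the hub.\<close>

definition write_header :: com where
  "write_header = seq [Const rT 0, Store 20 rT rBase, Store 20 rOne rEdges, Const rT 2,
     Add rIn rN rOne, Store 20 rT rIn]"

text \<open>Register 20 is register 0 of the simulated program, which expects the length of its
  input there.\<close>

definition set_length :: com where
  "set_length = seq [Const rT 0, Add 20 rOut rT]"

definition build_graph :: com where
  "build_graph = Seq read_header (Seq (While rM clause_body) (Seq write_header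
     (Seq (While rIn hub_body) set_length)))"

definition read_answer :: com where
  "read_answer = Seq (Load rRef 21 rN) (While rN answer_body)"

definition flat :: "(nat \<times> nat) list \<Rightarrow> nat list" where
  "flat es = concat (map (\<lambda>(u, v). [u, v]) es)"

text \<open>The frame condition of the loops that build the graph: the formula survives, and apart
  from array 20 the memory of the simulated program remains zero.\<close>

definition untouched :: "state \<Rightarrow> state \<Rightarrow> bool" where
  "untouched s s' \<longleftrightarrow> regs s' rOne = regs s rOne \<and> regs s' rN = regs s rN \<and>
     (\<forall>x\<ge>20. regs s' x = regs s x) \<and> (\<forall>a. a \<noteq> 20 \<longrightarrow> arrs s' a = arrs s a)"

lemma untouched_refl: "untouched s s"
  by (simp add: untouched_def)

lemma untouched_trans: "untouched s s' \<Longrightarrow> untouched s' s'' \<Longrightarrow> untouched s s''"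
  by (simp add: untouched_def)

lemma apply_emits:
  assumes "regs s rOne = 1" "arrs s 20 = array_of w" "regs s rOut = length w"
    "\<forall>(r, k)\<in>set L. r \<noteq> rT \<and> r \<noteq> rOut"
    and s': "s' = apply_com (seq (map emit L)) s"
  shows "\<forall>x. x \<noteq> rT \<and> x \<noteq> rOut \<longrightarrow> regs s' x = regs s x" "regs s' rOut = length w + length L"
    "arrs s' = (arrs s)(20 := array_of (w @ map (\<lambda>(r, k). regs s r + k) L))"
proof -
  have "(\<forall>x. x \<noteq> rT \<and> x \<noteq> rOut \<longrightarrow> regs s' x = regs s x) \<and> regs s' rOut = length w + length L \<and>
    arrs s' = (arrs s)(20 := array_of (w @ map (\<lambda>(r, k). regs s r + k) L))"
    using assms
  proof (induction L arbitrary: s w)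
    case Nil
    then show ?case
      by (auto simp: fun_eq_iff)
  next
    case (Cons e L)
    obtain r k where e: "e = (r, k)"
      by (cases e)
    define t where "t = apply_com (emit e) s"
    have t: "\<forall>x. x \<noteq> rT \<and> x \<noteq> rOut \<longrightarrow> regs t x = regs s x" "regs t rOut = Suc (length w)"
      "arrs t = (arrs s)(20 := array_of (w @ [regs s r + k]))"
      using Cons.prems(1-4) unfolding t_def e
      by (auto simp: emit_def array_of_snoc add.commute)
    have L: "\<forall>(r, k)\<in>set L. r \<noteq> rT \<and> r \<noteq> rOut"
      using Cons.prems(4) by auto
    have m: "map (\<lambda>(r, k). regs t r + k) L = map (\<lambda>(r, k). regs s r + k) L"
      using t(1) L by auto
    show ?case
      using Cons.IH[of t "w @ [regs s r + k]"] Cons.prems(1,5) t L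
      by (simp add: m e t_def[symmetric, unfolded e] fun_eq_iff)
  qed
  then show "\<forall>x. x \<noteq> rT \<and> x \<noteq> rOut \<longrightarrow> regs s' x = regs s x" "regs s' rOut = length w + length L"
    "arrs s' = (arrs s)(20 := array_of (w @ map (\<lambda>(r, k). regs s r + k) L))"
    by auto
qed

lemma flat_gadget:
  assumes "regs s rN = n" "regs s rBase = b"
    "\<And>j. j < 3 \<Longrightarrow> regs s (rVar j) = fst (pad_clause n c ! j)"
    "\<And>j. j < 3 \<Longrightarrow> regs s (rPort j) = b + of_bool (snd (pad_clause n c ! j))"
  shows "map (\<lambda>(r, k). regs s r + k) gadget_code = flat (gadget n b c)"
  using assms(1,2) assms(3)[of 0] assms(3)[of 1] assms(3)[of 2]
    assms(4)[of 0] assms(4)[of 1] assms(4)[of 2]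
  by (simp add: gadget_code_def flat_def gadget_def literal_edge_def)

lemma apply_read_literal:
  assumes "regs s rOne = 1" "regs s rLen = Suc k" "j < 3"
  shows "regs (apply_com (read_literal j) s) = (regs s)(rVar j := arrs s 0 (regs s rIn),
      rPort j := regs s rBase + arrs s 0 (Suc (regs s rIn)), rIn := Suc (Suc (regs s rIn)), rLen := k)"
    "arrs (apply_com (read_literal j) s) = arrs s"
  using assms by (auto simp: read_literal_def fun_eq_iff)

lemma apply_pad_literal:
  assumes "regs s rOne = 1" "regs s rLen = 0" "j < 3"
  shows "regs (apply_com (read_literal j) s) =
      (regs s)(rVar j := regs s rN, rPort j := Suc (regs s rBase))"
    "arrs (apply_com (read_literal j) s) = arrs s"
  using assms by (auto simp: read_literal_def fun_eq_iff)

lemma pad_clause_nth: "j < 3 \<Longrightarrow> pad_clause n c ! j = (if j < length c then c ! j else (n, True))"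
  by (simp add: pad_clause_def nth_append)

lemma encode_clause_nth:
  assumes "j < length c"
  shows "array_of (encode_clause c @ v) (Suc (2 * j)) = fst (c ! j)"
    "array_of (encode_clause c @ v) (Suc (Suc (2 * j))) = of_bool (snd (c ! j))"
proof -
  have "array_of (concat (map (\<lambda>(x, b). [x, of_bool b]) c) @ v) (2 * j) = fst (c ! j) \<and>
    array_of (concat (map (\<lambda>(x, b). [x, of_bool b]) c) @ v) (Suc (2 * j)) = of_bool (snd (c ! j))"
    using assms
  proof (induction c arbitrary: j)
    case (Cons l c)
    then show ?case
      by (cases j; cases l) auto
  qed simp
  then show "array_of (encode_clause c @ v) (Suc (2 * j)) = fst (c ! j)"
    "array_of (encode_clause c @ v) (Suc (Suc (2 * j))) = of_bool (snd (c ! j))"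
    by (simp_all add: encode_clause_def)
qed

lemma length_encode_clause: "length (encode_clause c) = Suc (2 * length c)"
proof -
  have "length (concat (map (\<lambda>(x, b). [x, of_bool b]) c)) = 2 * length c"
    by (induction c) auto
  then show ?thesis
    by (simp add: encode_clause_def)
qed

text \<open>Truncated subtraction and \<open>min\<close> describe the state before literal
  \<open>j\<close> in both situations, reading and padding, so that three applications can be
  chained.\<close>

lemma apply_read_clause_step:
  assumes "regs s rOne = 1" "regs s rN = n" "regs s rBase = b"
    "arrs s 0 = array_of (v @ encode_clause c @ v')" "j < 3"
    "regs s rLen = length c - j" "regs s rIn = length v + Suc (2 * min j (length c))"
    and s': "s' = apply_com (read_literal j) s"
  shows "regs s' (rVar j) = fst (pad_clause n c ! j)"
    "regs s' (rPort j) = b + of_bool (snd (pad_clause n c ! j))"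
    "regs s' rLen = length c - Suc j" "regs s' rIn = length v + Suc (2 * min (Suc j) (length c))"
    "\<forall>x. x \<notin> {rLen, rIn, rVar j, rPort j} \<longrightarrow> regs s' x = regs s x" "arrs s' = arrs s"
proof -
  have "regs s' (rVar j) = fst (pad_clause n c ! j) \<and>
    regs s' (rPort j) = b + of_bool (snd (pad_clause n c ! j)) \<and>
    regs s' rLen = length c - Suc j \<and> regs s' rIn = length v + Suc (2 * min (Suc j) (length c)) \<and>
    (\<forall>x. x \<notin> {rLen, rIn, rVar j, rPort j} \<longrightarrow> regs s' x = regs s x) \<and> arrs s' = arrs s"
  proof (cases "j < length c")
    case True
    then have "regs s rLen = Suc (length c - Suc j)" "regs s rIn = length v + Suc (2 * j)"
      using assms(6,7) by auto
    then show ?thesis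
      using True assms(3-5) unfolding s'
      by (simp add: apply_read_literal[OF assms(1) _ assms(5)] encode_clause_nth pad_clause_nth)
  next
    case False
    then have "regs s rLen = 0" "regs s rIn = length v + Suc (2 * length c)"
      using assms(6,7) by auto
    then show ?thesis
      using False assms(2-5) unfolding s'
      by (simp add: apply_pad_literal[OF assms(1) _ assms(5)] pad_clause_nth)
  qed
  then show "regs s' (rVar j) = fst (pad_clause n c ! j)"
    "regs s' (rPort j) = b + of_bool (snd (pad_clause n c ! j))"
    "regs s' rLen = length c - Suc j" "regs s' rIn = length v + Suc (2 * min (Suc j) (length c))"
    "\<forall>x. x \<notin> {rLen, rIn, rVar j, rPort j} \<longrightarrow> regs s' x = regs s x" "arrs s' = arrs s"
    by blast+
qed

lemma apply_read_clause:
  assumes "regs s rOne = 1" "regs s rN = n" "regs s rBase = b"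
    "arrs s 0 = array_of (v @ encode_clause c @ v')" "regs s rIn = length v" "length c \<le> 3"
    and s': "s' = apply_com (seq [Load rLen 0 rIn, Add rIn rIn rOne, read_literal 0, read_literal 1,
      read_literal 2]) s"
  shows "\<forall>j<3. regs s' (rVar j) = fst (pad_clause n c ! j)"
    "\<forall>j<3. regs s' (rPort j) = b + of_bool (snd (pad_clause n c ! j))"
    "regs s' rIn = length v + length (encode_clause c)"
    "\<forall>x. x \<notin> {rLen, rIn} \<union> {10..16} \<longrightarrow> regs s' x = regs s x" "arrs s' = arrs s"
proof -
  define t\<^sub>0 where "t\<^sub>0 = apply_com (seq [Load rLen 0 rIn, Add rIn rIn rOne]) s"
  define t\<^sub>1 where "t\<^sub>1 = apply_com (read_literal 0) t\<^sub>0"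
  define t\<^sub>2 where "t\<^sub>2 = apply_com (read_literal 1) t\<^sub>1"
  have s'': "s' = apply_com (read_literal 2) t\<^sub>2"
    unfolding s' t\<^sub>2_def t\<^sub>1_def t\<^sub>0_def by simp
  have r: "regs t\<^sub>0 = (regs s)(rLen := length c, rIn := Suc (length v))" and a: "arrs t\<^sub>0 = arrs s"
    using assms(1,4,5) by (simp_all add: t\<^sub>0_def encode_clause_def)
  note step = apply_read_clause_step[where n = n and b = b and c = c and v = v and v' = v']
  have t1: "regs t\<^sub>1 (rVar 0) = fst (pad_clause n c ! 0)"
    "regs t\<^sub>1 (rPort 0) = b + of_bool (snd (pad_clause n c ! 0))"
    "regs t\<^sub>1 rLen = length c - Suc 0" "regs t\<^sub>1 rIn = length v + Suc (2 * min (Suc 0) (length c))"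
    "\<forall>x. x \<notin> {rLen, rIn, rVar 0, rPort 0} \<longrightarrow> regs t\<^sub>1 x = regs t\<^sub>0 x" "arrs t\<^sub>1 = arrs t\<^sub>0"
    by (rule step[OF _ _ _ _ _ _ _ t\<^sub>1_def]; use assms(1-4) in \<open>simp add: r a\<close>)+
  have t2: "regs t\<^sub>2 (rVar 1) = fst (pad_clause n c ! 1)"
    "regs t\<^sub>2 (rPort 1) = b + of_bool (snd (pad_clause n c ! 1))"
    "regs t\<^sub>2 rLen = length c - Suc 1" "regs t\<^sub>2 rIn = length v + Suc (2 * min (Suc 1) (length c))"
    "\<forall>x. x \<notin> {rLen, rIn, rVar 1, rPort 1} \<longrightarrow> regs t\<^sub>2 x = regs t\<^sub>1 x" "arrs t\<^sub>2 = arrs t\<^sub>1"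
    by (rule step[OF _ _ _ _ _ _ _ t\<^sub>2_def]; use assms(1-4) in \<open>simp add: t1 r a\<close>)+
  have t3: "regs s' (rVar 2) = fst (pad_clause n c ! 2)"
    "regs s' (rPort 2) = b + of_bool (snd (pad_clause n c ! 2))"
    "regs s' rLen = length c - Suc 2" "regs s' rIn = length v + Suc (2 * min (Suc 2) (length c))"
    "\<forall>x. x \<notin> {rLen, rIn, rVar 2, rPort 2} \<longrightarrow> regs s' x = regs t\<^sub>2 x" "arrs s' = arrs t\<^sub>2"
    by (rule step[OF _ _ _ _ _ _ _ s'']; use assms(1-4) in \<open>simp add: t2 t1 r a\<close>)+
  have all3: "(\<forall>j<3. R j) \<longleftrightarrow> R 0 \<and> R 1 \<and> R 2" for R :: "nat \<Rightarrow> bool"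
    by (auto simp: numeral_eq_Suc less_Suc_eq)
  show "\<forall>j<3. regs s' (rVar j) = fst (pad_clause n c ! j)"
    "\<forall>j<3. regs s' (rPort j) = b + of_bool (snd (pad_clause n c ! j))"
    unfolding all3 using t1(1,2) t2(1,2,5) t3(1,2,5) by simp_all
  show "regs s' rIn = length v + length (encode_clause c)"
    using t3(4) assms(6) by (simp add: length_encode_clause)
  show "arrs s' = arrs s"
    by (simp add: t1 t2 t3 a)
  show "\<forall>x. x \<notin> {rLen, rIn} \<union> {10..16} \<longrightarrow> regs s' x = regs s x"
    using t1(5) t2(5) t3(5) by (auto simp: r)
qed

lemma flat_simps [simp]:
  "flat [] = []" "flat (es @ es') = flat es @ flat es'"
  by (simp_all add: flat_def)

lemma apply_clause_body:
  assumes "regs s rOne = 1" "regs s rN = n" "regs s rBase = b"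
    "arrs s 0 = array_of (v @ encode_clause c @ v')" "regs s rIn = length v" "length c \<le> 3"
    "arrs s 20 = array_of w" "regs s rOut = length w"
    and s': "s' = apply_com clause_body s"
  shows "regs s' rIn = length v + length (encode_clause c)" "regs s' rM = regs s rM - 1"
    "regs s' rBase = b + 7" "regs s' rEdges = regs s rEdges + 16"
    "arrs s' 20 = array_of (w @ flat (gadget n b c))"
    "regs s' rOut = length (w @ flat (gadget n b c))" "untouched s s'"
proof -
  define t where "t = apply_com (seq [Load rLen 0 rIn, Add rIn rIn rOne, read_literal 0, read_literal 1,
    read_literal 2]) s"
  note t = apply_read_clause[OF assms(1-6) t_def]
  define u where "u = apply_com (seq (map emit gadget_code)) t"
  have tr: "regs t rOne = 1" "regs t rN = n" "regs t rBase = b" "regs t rOut = length w"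
    "regs t rM = regs s rM" "regs t rEdges = regs s rEdges" "\<forall>x\<ge>20. regs t x = regs s x"
    using t(4) assms by auto
  have code: "\<forall>(r, k)\<in>set gadget_code. r \<noteq> rT \<and> r \<noteq> rOut"
    by (simp add: gadget_code_def)
  have "arrs t 20 = array_of w"
    using t(5) assms by simp
  note u = apply_emits[OF tr(1) this tr(4) code u_def]
  have g: "map (\<lambda>(r, k). regs t r + k) gadget_code = flat (gadget n b c)"
    by (rule flat_gadget) (use t tr in auto)
  have len: "length gadget_code = length (flat (gadget n b c))"
    unfolding g[symmetric] by simp
  have s': "s' = apply_com (seq [Const rT 7, Add rBase rBase rT, Const rT 16, Add rEdges rEdges rT,
    Sub rM rM rOne]) u"
    unfolding s' clause_body_def by (simp add: u_def t_def)
  have ur: "regs u x = regs t x" if "x \<noteq> rT" "x \<noteq> rOut" for x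
    using u(1) that by blast
  have s'r: "regs s' = (regs u)(rT := 16, rBase := b + 7, rEdges := regs s rEdges + 16, rM := regs s rM - 1)"
    using tr unfolding s' by (auto simp: ur fun_eq_iff)
  have s'a: "arrs s' = arrs u"
    unfolding s' by simp
  show "regs s' rIn = length v + length (encode_clause c)" "regs s' rM = regs s rM - 1"
    "regs s' rBase = b + 7" "regs s' rEdges = regs s rEdges + 16"
    "arrs s' 20 = array_of (w @ flat (gadget n b c))"
    "regs s' rOut = length (w @ flat (gadget n b c))"
    using t(3) u(2) by (simp_all add: s'r s'a ur u(3) g len)
  show "untouched s s'"
    unfolding untouched_def using tr assms(1,2) t(5) by (simp add: s'r s'a ur u(3))
qed

lemma loop_free_clause_body: "loop_free clause_body"
  by (simp add: clause_body_def loop_free_seq read_literal_def emit_def gadget_code_def)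

lemma loop_free_hub_body: "loop_free hub_body"
  by (simp add: hub_body_def loop_free_seq emit_def)

lemma loop_free_answer_body: "loop_free answer_body"
  by (simp add: answer_body_def loop_free_seq)

section \<open>The loops, by induction on the number of rounds\<close>

lemma runs_clause_loop:
  assumes "regs s rOne = 1" "regs s rN = n" "regs s rBase = b" "regs s rM = length cs"
    "arrs s 0 = array_of (v @ concat (map encode_clause cs))" "regs s rIn = length v"
    "\<forall>c\<in>set cs. length c \<le> 3" "arrs s 20 = array_of w" "regs s rOut = length w"
  shows "\<exists>s'. runs (While rM clause_body) s (length cs * Suc (steps clause_body) + 1) s' \<and>
    regs s' rBase = b + 7 * length cs \<and> regs s' rEdges = regs s rEdges + 16 * length cs \<and>
    arrs s' 20 = array_of (w @ flat (graph_edges n b cs)) \<and>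
    regs s' rOut = length (w @ flat (graph_edges n b cs)) \<and> untouched s s'"
  using assms
proof (induction cs arbitrary: s b v w)
  case Nil
  then show ?case
    using runs_While_False[of s rM clause_body] by (intro exI[of _ s]) (simp add: untouched_refl)
next
  case (Cons c cs)
  define t where "t = apply_com clause_body s"
  have "arrs s 0 = array_of (v @ encode_clause c @ concat (map encode_clause cs))" "length c \<le> 3"
    using Cons.prems by auto
  note t = apply_clause_body[OF Cons.prems(1,2,3) this(1) Cons.prems(6) this(2) Cons.prems(8,9) t_def]
  have "\<exists>s'. runs (While rM clause_body) t (length cs * Suc (steps clause_body) + 1) s' \<and>
    regs s' rBase = (b + 7) + 7 * length cs \<and> regs s' rEdges = regs t rEdges + 16 * length cs \<and>
    arrs s' 20 = array_of ((w @ flat (gadget n b c)) @ flat (graph_edges n (b + 7) cs)) \<and>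
    regs s' rOut = length ((w @ flat (gadget n b c)) @ flat (graph_edges n (b + 7) cs)) \<and> untouched t s'"
    using Cons.prems t
    by (intro Cons.IH[where v = "v @ encode_clause c"]) (auto simp: untouched_def)
  then obtain s' where s': "runs (While rM clause_body) t (length cs * Suc (steps clause_body) + 1) s'"
    "regs s' rBase = (b + 7) + 7 * length cs" "regs s' rEdges = regs t rEdges + 16 * length cs"
    "arrs s' 20 = array_of ((w @ flat (gadget n b c)) @ flat (graph_edges n (b + 7) cs))"
    "regs s' rOut = length ((w @ flat (gadget n b c)) @ flat (graph_edges n (b + 7) cs))" "untouched t s'"
    by blast
  have "runs (While rM clause_body) s (Suc (length cs) * Suc (steps clause_body) + 1) s'"
    using s'(1) Cons.prems(4) unfolding t_def
    by (intro runs_While_step loop_free_clause_body) auto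
  then show ?case
    using s' t(4) untouched_trans[OF t(7) s'(6)] by (intro exI[of _ s']) simp
qed

lemma runs_hub_loop:
  assumes "regs s rOne = 1" "regs s rIn = m" "arrs s 20 = array_of w" "regs s rOut = length w"
  shows "\<exists>s'. runs (While rIn hub_body) s (m * Suc (steps hub_body) + 1) s' \<and>
    arrs s' 20 = array_of (w @ rev [0..<m]) \<and> regs s' rOut = length w + m \<and> untouched s s'"
  using assms
proof (induction m arbitrary: s w)
  case 0
  then show ?case
    using runs_While_False[of s rIn hub_body] by (intro exI[of _ s]) (simp add: untouched_refl)
next
  case (Suc m)
  define t where "t = apply_com hub_body s"
  have t: "regs t rIn = m" "arrs t 20 = array_of (w @ [m])" "regs t rOut = length (w @ [m])"
    "regs t rOne = 1" "untouched s t"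
    using Suc.prems by (simp_all add: t_def hub_body_def emit_def array_of_snoc untouched_def)
  obtain s' where s': "runs (While rIn hub_body) t (m * Suc (steps hub_body) + 1) s'"
    "arrs s' 20 = array_of ((w @ [m]) @ rev [0..<m])" "regs s' rOut = length (w @ [m]) + m" "untouched t s'"
    using Suc.IH[OF t(4,1,2,3)] by blast
  have "runs (While rIn hub_body) s (Suc m * Suc (steps hub_body) + 1) s'"
    using s'(1) Suc.prems(2) unfolding t_def
    by (intro runs_While_step loop_free_hub_body) auto
  then show ?case
    using s' untouched_trans[OF t(5) s'(4)] by (intro exI[of _ s']) simp
qed

text \<open>The counter descends, so each round finishes its topmost cell; the else branch records
  that later rounds leave it alone.\<close>

lemma runs_answer_loop:
  assumes "regs s rOne = 1" "regs s rN = n"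
  shows "\<exists>s'. runs (While rN answer_body) s (n * Suc (steps answer_body) + 1) s' \<and>
    (\<forall>x. arrs s' 1 x \<noteq> 0 \<longleftrightarrow>
      (if x < n then (arrs s 21 x \<noteq> 0) \<noteq> (regs s rRef \<noteq> 0) else arrs s 1 x \<noteq> 0))"
  using assms
proof (induction n arbitrary: s)
  case 0
  then show ?case
    using runs_While_False[of s rN answer_body] by (intro exI[of _ s]) simp
next
  case (Suc n)
  define t where "t = apply_com answer_body s"
  have t: "regs t rOne = 1" "regs t rN = n" "regs t rRef = regs s rRef" "arrs t 21 = arrs s 21"
    "\<forall>x. x \<noteq> n \<longrightarrow> arrs t 1 x = arrs s 1 x"
    "arrs t 1 n \<noteq> 0 \<longleftrightarrow> (arrs s 21 n \<noteq> 0) \<noteq> (regs s rRef \<noteq> 0)"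
    using Suc.prems by (simp_all add: t_def answer_body_def)
  obtain s' where s': "runs (While rN answer_body) t (n * Suc (steps answer_body) + 1) s'"
    "\<forall>x. arrs s' 1 x \<noteq> 0 \<longleftrightarrow>
      (if x < n then (arrs t 21 x \<noteq> 0) \<noteq> (regs t rRef \<noteq> 0) else arrs t 1 x \<noteq> 0)"
    using Suc.IH[OF t(1,2)] by blast
  have "runs (While rN answer_body) s (Suc n * Suc (steps answer_body) + 1) s'"
    using s'(1) Suc.prems(2) unfolding t_def
    by (intro runs_While_step loop_free_answer_body) auto
  moreover have "arrs s' 1 x \<noteq> 0 \<longleftrightarrow>
      (if x < Suc n then (arrs s 21 x \<noteq> 0) \<noteq> (regs s rRef \<noteq> 0) else arrs s 1 x \<noteq> 0)" for x
    using s'(2)[rule_format, of x] t(3-6) by (cases "x = n") auto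
  ultimately show ?case
    by (intro exI[of _ s']) simp
qed

section \<open>Polynomial bounds\<close>

text \<open>A bound valid for every \<open>n\<close> can be evaluated at the size of the constructed
  graph and is monotone there.\<close>

lemma poly_bounded_iff: "poly_bounded f \<longleftrightarrow> (\<exists>c k. \<forall>n. f n \<le> c * (n + 1) ^ k)"
proof
  assume "poly_bounded f"
  then obtain k c where "c > 0" "\<forall>\<^sub>F n in at_top. norm (real (f n)) \<le> c * norm (real n ^ k)"
    unfolding poly_bounded_def by (auto elim!: landau_o.bigE)
  then obtain N where N: "\<And>n. n \<ge> N \<Longrightarrow> real (f n) \<le> c * real n ^ k"
    by (auto simp: eventually_at_top_linorder)
  \<comment> \<open>The sum covers the finitely many arguments below \<open>N\<close>.\<close>
  define C where "C = nat \<lceil>c\<rceil> + (\<Sum>i<N. f i)"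
  have "f n \<le> C * (n + 1) ^ k" for n
  proof (cases "n < N")
    case True
    then have "f n \<le> (\<Sum>i<N. f i)"
      by (intro member_le_sum) auto
    also have "\<dots> \<le> C * 1"
      by (simp add: C_def)
    also have "\<dots> \<le> C * (n + 1) ^ k"
      by (intro mult_le_mono2) simp
    finally show ?thesis .
  next
    case False
    then have "real (f n) \<le> c * real n ^ k"
      using N by simp
    also have "\<dots> \<le> real C * real n ^ k"
    proof (rule mult_right_mono)
      show "c \<le> real C"
        using real_nat_ceiling_ge[of c] unfolding C_def of_nat_add by linarith
    qed simp
    also have "\<dots> \<le> real C * real (n + 1) ^ k"
      by (intro mult_left_mono power_mono) auto
    also have "\<dots> = real (C * (n + 1) ^ k)"
      by simp
    finally show ?thesis
      by (simp only: of_nat_le_iff)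
  qed
  then show "\<exists>c k. \<forall>n. f n \<le> c * (n + 1) ^ k"
    by blast
next
  assume "\<exists>c k. \<forall>n. f n \<le> c * (n + 1) ^ k"
  then obtain c k where f: "\<And>n. f n \<le> c * (n + 1) ^ k"
    by blast
  have "norm (real (f n)) \<le> real (c * 2 ^ k) * norm (real n ^ k)" if "n \<ge> 1" for n
  proof -
    have "f n \<le> c * (n + 1) ^ k"
      by (rule f)
    also have "\<dots> \<le> c * (2 * n) ^ k"
      using that by (intro mult_le_mono2 power_mono) auto
    finally have "f n \<le> c * 2 ^ k * n ^ k"
      by (simp add: power_mult_distrib ac_simps)
    then have "real (f n) \<le> real (c * 2 ^ k * n ^ k)"
      by (simp only: of_nat_le_iff)
    then show ?thesis
      by simp
  qed
  then have "(\<lambda>n. real (f n)) \<in> O(\<lambda>n. real n ^ k)"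
    by (intro bigoI[of _ "real (c * 2 ^ k)"] eventually_mono[OF eventually_ge_at_top[of 1]]) auto
  then show "poly_bounded f"
    unfolding poly_bounded_def by blast
qed

lemma poly_bounded_const: "poly_bounded (\<lambda>n. c)"
  unfolding poly_bounded_iff by (intro exI[of _ c] exI[of _ 0]) simp

lemma poly_bounded_id: "poly_bounded (\<lambda>n. n)"
  unfolding poly_bounded_iff by (intro exI[of _ 1] exI[of _ 1]) simp

lemma poly_bounded_add:
  assumes "poly_bounded f" "poly_bounded g"
  shows "poly_bounded (\<lambda>n. f n + g n)"
proof -
  obtain c k d l where b: "\<And>n. f n \<le> c * (n + 1) ^ k" "\<And>n. g n \<le> d * (n + 1) ^ l"
    using assms unfolding poly_bounded_iff by blast
  have "f n + g n \<le> (c + d) * (n + 1) ^ (k + l)" for n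
  proof -
    have "c * (n + 1) ^ k \<le> c * (n + 1) ^ (k + l)" "d * (n + 1) ^ l \<le> d * (n + 1) ^ (k + l)"
      by (intro mult_le_mono2 power_increasing; simp)+
    then have "f n + g n \<le> c * (n + 1) ^ (k + l) + d * (n + 1) ^ (k + l)"
      using b[of n] by linarith
    then show ?thesis
      by (simp only: add_mult_distrib)
  qed
  then show ?thesis
    unfolding poly_bounded_iff by blast
qed

lemma poly_bounded_mult:
  assumes "poly_bounded f" "poly_bounded g"
  shows "poly_bounded (\<lambda>n. f n * g n)"
proof -
  obtain c k d l where b: "\<And>n. f n \<le> c * (n + 1) ^ k" "\<And>n. g n \<le> d * (n + 1) ^ l"
    using assms unfolding poly_bounded_iff by blast
  have "f n * g n \<le> (c * d) * (n + 1) ^ (k + l)" for n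
    using mult_le_mono[OF b[of n]] by (simp add: power_add ac_simps)
  then show ?thesis
    unfolding poly_bounded_iff by blast
qed

lemma poly_bounded_Suc: "poly_bounded f \<Longrightarrow> poly_bounded (\<lambda>n. Suc (f n))"
  using poly_bounded_add[OF _ poly_bounded_const[of 1]] by simp

lemma poly_bounded_power: "poly_bounded f \<Longrightarrow> poly_bounded (\<lambda>n. f n ^ k)"
  by (induction k) (auto intro: poly_bounded_const poly_bounded_mult)

lemmas poly_bounded_intros = poly_bounded_const poly_bounded_id poly_bounded_add poly_bounded_mult
  poly_bounded_Suc poly_bounded_power

section \<open>The reduction\<close>

definition build_steps :: "nat \<Rightarrow> nat \<Rightarrow> nat" where
  "build_steps n m = steps read_header + ((m * Suc (steps clause_body) + 1) +
     (steps write_header + ((Suc n * Suc (steps hub_body) + 1) + steps set_length)))"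

definition answer_steps :: "nat \<Rightarrow> nat" where
  "answer_steps n = 1 + (n * Suc (steps answer_body) + 1)"

lemma input_state_array_of:
  "input_state w = \<lparr>regs = (\<lambda>x. 0)(0 := length w), arrs = (\<lambda>a i. 0)(0 := array_of w)\<rparr>"
  by (simp add: input_state_def array_of_def[abs_def])

text \<open>An empty array is read as a word with three blank header cells, the start of the output
  invariant.\<close>

lemma array_of_zeros: "array_of [0, 0, 0] = (\<lambda>i. 0)"
  by (auto simp: array_of_def fun_eq_iff nth_Cons split: nat.splits)

text \<open>Seen from index 20 on, the final state is exactly an initial state of the Max Cut
  program, so a run of that program can be transplanted by \<open>exec_shift\<close>.\<close>

lemma runs_build_graph:
  assumes "\<forall>c\<in>set cs. length c \<le> 3"
  obtains s where "runs build_graph (input_state (encode_cnf n cs)) (build_steps n (length cs)) s"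
    "drop_state 20 s = input_state (encode_graph_hub (Suc n + 7 * length cs)
      (graph_edges n (Suc n) cs) (rev [0..<Suc n]))"
    "regs s rOne = 1" "regs s rN = n"
proof -
  let ?w = "encode_cnf n cs" and ?es = "flat (graph_edges n (Suc n) cs)"
  define s\<^sub>0 where "s\<^sub>0 = input_state ?w"
  define s\<^sub>1 where "s\<^sub>1 = apply_com read_header s\<^sub>0"
  have s0: "regs s\<^sub>0 = (\<lambda>x. 0)(0 := length ?w)" "arrs s\<^sub>0 = (\<lambda>a i. 0)(0 := array_of ?w)"
    by (simp_all add: s\<^sub>0_def input_state_array_of)
  have w: "?w = [n, length cs] @ concat (map encode_clause cs)"
    by (simp add: encode_cnf_def)
  have s1: "regs s\<^sub>1 = (\<lambda>x. 0)(rOne := 1, rN := n, rM := length cs, rIn := 2, rBase := Suc n, rOut := 3)"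
    "arrs s\<^sub>1 = arrs s\<^sub>0"
    unfolding s\<^sub>1_def read_header_def by (auto simp: s0 w fun_eq_iff)
  have r1: "runs read_header s\<^sub>0 (steps read_header) s\<^sub>1"
    unfolding s\<^sub>1_def by (rule runs_loop_free) (simp add: read_header_def loop_free_seq)
  obtain s\<^sub>2 where s2: "runs (While rM clause_body) s\<^sub>1 (length cs * Suc (steps clause_body) + 1) s\<^sub>2"
    "regs s\<^sub>2 rBase = Suc n + 7 * length cs" "regs s\<^sub>2 rEdges = regs s\<^sub>1 rEdges + 16 * length cs"
    "arrs s\<^sub>2 20 = array_of ([0, 0, 0] @ ?es)" "regs s\<^sub>2 rOut = length ([0, 0, 0] @ ?es)"
    "untouched s\<^sub>1 s\<^sub>2"
  proof -
    have "\<exists>s'. runs (While rM clause_body) s\<^sub>1 (length cs * Suc (steps clause_body) + 1) s' \<and>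
      regs s' rBase = Suc n + 7 * length cs \<and> regs s' rEdges = regs s\<^sub>1 rEdges + 16 * length cs \<and>
      arrs s' 20 = array_of ([0, 0, 0] @ ?es) \<and> regs s' rOut = length ([0, 0, 0] @ ?es) \<and> untouched s\<^sub>1 s'"
      by (rule runs_clause_loop[where v = "[n, length cs]"])
        (use assms in \<open>simp_all add: s1 s0 w array_of_zeros\<close>)
    then show ?thesis
      using that by blast
  qed
  define s\<^sub>3 where "s\<^sub>3 = apply_com write_header s\<^sub>2"
  let ?v = "(Suc n + 7 * length cs) # (16 * length cs) # Suc n # ?es"
  have u2: "regs s\<^sub>2 rOne = 1" "regs s\<^sub>2 rN = n" "\<forall>x\<ge>20. regs s\<^sub>2 x = 0" "\<forall>a>20. arrs s\<^sub>2 a = (\<lambda>i. 0)"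
    using s2(6) unfolding untouched_def by (auto simp: s1 s0)
  have s3: "regs s\<^sub>3 rOne = 1" "regs s\<^sub>3 rN = n" "\<forall>x\<ge>20. regs s\<^sub>3 x = 0" "\<forall>a>20. arrs s\<^sub>3 a = (\<lambda>i. 0)"
    "regs s\<^sub>3 rIn = Suc n" "regs s\<^sub>3 rOut = length ?v"
    using s2(2-5) u2 by (simp_all add: s\<^sub>3_def write_header_def s1)
  have "arrs s\<^sub>3 20 = (array_of (0 # 0 # 0 # ?es))
      (0 := Suc n + 7 * length cs, 1 := 16 * length cs, 2 := Suc n)"
    using s2(2-5) u2 by (simp add: s\<^sub>3_def write_header_def s1)
  then have a3: "arrs s\<^sub>3 20 = array_of ?v"
    unfolding array_of_header .
  have r3: "runs write_header s\<^sub>2 (steps write_header) s\<^sub>3"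
    unfolding s\<^sub>3_def by (rule runs_loop_free) (simp add: write_header_def loop_free_seq)
  obtain s\<^sub>4 where s4: "runs (While rIn hub_body) s\<^sub>3 (Suc n * Suc (steps hub_body) + 1) s\<^sub>4"
    "arrs s\<^sub>4 20 = array_of (?v @ rev [0..<Suc n])" "regs s\<^sub>4 rOut = length ?v + Suc n"
    "untouched s\<^sub>3 s\<^sub>4"
    using runs_hub_loop[OF s3(1,5) a3 s3(6)] by blast
  define s\<^sub>5 where "s\<^sub>5 = apply_com set_length s\<^sub>4"
  have r5: "runs set_length s\<^sub>4 (steps set_length) s\<^sub>5"
    unfolding s\<^sub>5_def by (rule runs_loop_free) (simp add: set_length_def loop_free_seq)
  have s5: "regs s\<^sub>5 = (regs s\<^sub>4)(rT := 0, 20 := length ?v + Suc n)" "arrs s\<^sub>5 = arrs s\<^sub>4"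
    by (simp_all add: s\<^sub>5_def set_length_def s4(3))
  have u4: "regs s\<^sub>4 rOne = 1" "regs s\<^sub>4 rN = n" "\<forall>x\<ge>20. regs s\<^sub>4 x = 0" "\<forall>a>20. arrs s\<^sub>4 a = (\<lambda>i. 0)"
    using s4(4) s3 unfolding untouched_def by auto
  have e: "encode_graph_hub (Suc n + 7 * length cs) (graph_edges n (Suc n) cs) (rev [0..<Suc n]) =
    ?v @ rev [0..<Suc n]"
    by (simp add: encode_graph_hub_def flat_def length_graph_edges)
  show ?thesis
  proof (rule that)
    show "runs build_graph (input_state ?w) (build_steps n (length cs)) s\<^sub>5"
      unfolding build_graph_def build_steps_def s\<^sub>0_def[symmetric]
      by (intro runs_Seq[OF r1] runs_Seq[OF s2(1)] runs_Seq[OF r3] runs_Seq[OF s4(1)] r5)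
    have "regs (drop_state 20 s\<^sub>5) = (\<lambda>x. 0)(0 := length (?v @ rev [0..<Suc n]))"
      using u4 by (auto simp: s5 fun_eq_iff)
    moreover have "arrs (drop_state 20 s\<^sub>5) = (\<lambda>a i. 0)(0 := array_of (?v @ rev [0..<Suc n]))"
      using u4(4) by (auto simp: s5 s4(2) fun_eq_iff)
    ultimately show "drop_state 20 s\<^sub>5 = input_state (encode_graph_hub (Suc n + 7 * length cs)
      (graph_edges n (Suc n) cs) (rev [0..<Suc n]))"
      unfolding e input_state_array_of by simp
    show "regs s\<^sub>5 rOne = 1" "regs s\<^sub>5 rN = n"
      using u4 by (simp_all add: s5)
  qed
qed

lemma runs_read_answer:
  assumes "regs s rOne = 1" "regs s rN = n"
  obtains s' where "runs read_answer s (answer_steps n) s'"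
    "\<And>x. x < n \<Longrightarrow> arrs s' 1 x \<noteq> 0 \<longleftrightarrow> (arrs s 21 x \<noteq> 0) \<noteq> (arrs s 21 n \<noteq> 0)"
proof -
  define t where "t = set_reg rRef (arrs s 21 n) s"
  have "regs t rOne = 1" "regs t rN = n"
    using assms by (simp_all add: t_def)
  from runs_answer_loop[OF this]
  obtain s' where s': "runs (While rN answer_body) t (n * Suc (steps answer_body) + 1) s'"
    "\<forall>x. arrs s' 1 x \<noteq> 0 \<longleftrightarrow>
      (if x < n then (arrs t 21 x \<noteq> 0) \<noteq> (regs t rRef \<noteq> 0) else arrs t 1 x \<noteq> 0)"
    by blast
  have "runs (Load rRef 21 rN) s 1 t"
    using runs_Load[of rRef 21 rN s] assms(2) by (simp add: t_def)
  then have "runs read_answer s (answer_steps n) s'"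
    unfolding read_answer_def answer_steps_def using s'(1) by (rule runs_Seq)
  moreover have "arrs s' 1 x \<noteq> 0 \<longleftrightarrow> (arrs s 21 x \<noteq> 0) \<noteq> (arrs s 21 n \<noteq> 0)" if "x < n" for x
    using s'(2)[rule_format, of x] that by (simp add: t_def)
  ultimately show ?thesis
    by (rule that)
qed

lemma set_encode_cnf:
  assumes "\<forall>c\<in>set cs. length c \<le> 3 \<and> fst ` set c \<subseteq> {..<n}" "k \<in> set (encode_cnf n cs)"
  shows "k \<le> n + length cs + 3"
proof -
  have "k \<le> n + 3" if "c \<in> set cs" "k \<in> set (encode_clause c)" for c
  proof -
    have "length c \<le> 3" "fst ` set c \<subseteq> {..<n}"
      using assms(1) that(1) by auto
    then show ?thesis
      using that(2) by (auto simp: encode_clause_def)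
  qed
  moreover have "k = n \<or> k = length cs \<or> (\<exists>c\<in>set cs. k \<in> set (encode_clause c))"
    using assms(2) by (auto simp: encode_cnf_def)
  ultimately show ?thesis
    by (elim disjE bexE) (fastforce dest: trans_le_add1[of _ _ "length cs"])+
qed

lemma length_encode_cnf:
  assumes "\<forall>c\<in>set cs. length c \<le> 3"
  shows "length (encode_cnf n cs) \<le> 2 + 7 * length cs"
proof -
  have "length (concat (map encode_clause cs)) \<le> 7 * length cs"
    using assms by (induction cs) (auto simp: length_encode_clause)
  then show ?thesis
    by (simp add: encode_cnf_def)
qed

lemma bounded_input_state:
  assumes "\<And>k. k \<in> set w \<Longrightarrow> k \<le> L" "length w \<le> L"
  shows "bounded_state L (input_state w)"
  using assms by (auto simp: bounded_state_def input_state_def intro!: const_less_power)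

definition reduction :: "com \<Rightarrow> com" where
  "reduction P = Seq build_graph (Seq (shift 20 P) read_answer)"

text \<open>Dominates the entries and the length of the encoded formula as well as all constants of
  the program.\<close>

definition bits :: "com \<Rightarrow> nat \<Rightarrow> nat \<Rightarrow> nat" where
  "bits P n m = n + 8 * m + 5 + max_const (reduction P)"

text \<open>The cost of building the graph plus the part of the decoding cost that does not depend
  on the time of the simulated program.\<close>

definition overhead :: "com \<Rightarrow> nat \<Rightarrow> nat \<Rightarrow> nat" where
  "overhead P n m = build_steps n m * (2 * (bits P n m + build_steps n m) + 2) +
     answer_steps n * (2 * (bits P n m + build_steps n m + answer_steps n) + 2)"

text \<open>\<open>t'\<close> is the time of the simulated program. It enters once for the
  simulation and \<open>2 * answer_steps n\<close> times because the numbers to be decoded may have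
  \<open>t'\<close> additional bits.\<close>

lemma exec_reduction:
  assumes F: "three_cnf n F" "cnf_listing cs F"
    and P: "solves_max_cut_with_hub 7 4 P T"
  shows "\<exists>t s t'. exec (reduction P) (input_state (encode_cnf n cs)) t s \<and>
    real t' \<le> T (Suc n + 7 * length cs) (Suc n) \<and>
    t \<le> overhead P n (length cs) + (2 * answer_steps n + 1) * t' \<and>
    max_sat_optimal F (\<lambda>x. arrs s 1 x \<noteq> 0)"
proof -
  let ?m = "length cs" and ?N = "Suc n + 7 * length cs" and ?E = "cnf_graph n cs"
  let ?es = "graph_edges n (Suc n) cs" and ?qs = "rev [0..<Suc n]"
  let ?s = "input_state (encode_cnf n cs)" and ?L = "bits P n (length cs)"
  let ?k = "build_steps n (length cs)" and ?l = "answer_steps n"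
  note cs = clause_bounds[OF F]
  then have cs3: "\<forall>c\<in>set cs. length c \<le> 3"
    by blast
  have "set ?qs = {..<Suc n}"
    by auto
  then have "computes_within P (encode_graph_hub ?N ?es ?qs) (T ?N (card {..<Suc n}))
      (\<lambda>out. is_max_cut {..<?N} ?E {v. v < ?N \<and> out v \<noteq> 0})"
    using P[unfolded solves_max_cut_with_hub_def, rule_format, of ?N ?E "{..<Suc n}" ?es ?qs]
      simple_cnf_graph[OF F] hub_cnf_graph[OF F] edge_listing_cnf_graph[OF F] by simp
  then obtain t\<^sub>2 p where p: "exec P (input_state (encode_graph_hub ?N ?es ?qs)) t\<^sub>2 p"
    "real t\<^sub>2 \<le> T ?N (Suc n)" "is_max_cut {..<?N} ?E {v. v < ?N \<and> arrs p 1 v \<noteq> 0}"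
    unfolding computes_within_def card_lessThan by blast
  obtain s\<^sub>1 where s1: "runs build_graph ?s ?k s\<^sub>1"
    "drop_state 20 s\<^sub>1 = input_state (encode_graph_hub ?N ?es ?qs)"
    "regs s\<^sub>1 rOne = 1" "regs s\<^sub>1 rN = n"
    using runs_build_graph[OF cs3] by blast
  obtain s\<^sub>2 where s2: "exec (shift 20 P) s\<^sub>1 t\<^sub>2 s\<^sub>2" "drop_state 20 s\<^sub>2 = p" "same_below 20 s\<^sub>1 s\<^sub>2"
    using exec_shift[OF p(1) s1(2)] by blast
  have "regs s\<^sub>2 rOne = 1" "regs s\<^sub>2 rN = n"
    using s2(3) s1(3,4) by (simp_all add: same_below_def)
  from runs_read_answer[OF this] obtain s\<^sub>3 where s3: "runs read_answer s\<^sub>2 ?l s\<^sub>3"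
    "\<And>x. x < n \<Longrightarrow> arrs s\<^sub>3 1 x \<noteq> 0 \<longleftrightarrow> (arrs s\<^sub>2 21 x \<noteq> 0) \<noteq> (arrs s\<^sub>2 21 n \<noteq> 0)"
    by blast
  have out: "arrs p 1 = arrs s\<^sub>2 21"
    using s2(2) by auto
  have opt: "max_sat_optimal F (\<lambda>x. arrs s\<^sub>3 1 x \<noteq> 0)"
    using s3(2) by (intro max_cut_imp_optimal[OF F p(3)]) (simp add: out[simplified])
  have mc: "max_const build_graph \<le> ?L" "max_const P \<le> ?L" "max_const read_answer \<le> ?L"
    by (simp_all add: bits_def reduction_def)
  have "bounded_state ?L ?s"
  proof (rule bounded_input_state)
    show "k \<le> ?L" if "k \<in> set (encode_cnf n cs)" for k
      using set_encode_cnf[OF cs that] by (simp add: bits_def)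
    show "length (encode_cnf n cs) \<le> ?L"
      using length_encode_cnf[OF cs3, of n] by (simp add: bits_def)
  qed
  then obtain t\<^sub>1 where t1: "exec build_graph ?s t\<^sub>1 s\<^sub>1" "t\<^sub>1 \<le> ?k * (2 * (?L + ?k) + 2)"
    "bounded_state (?L + ?k) s\<^sub>1"
    using s1(1) mc(1) unfolding runs_def by blast
  have "bounded_state (?L + ?k + t\<^sub>2) s\<^sub>2"
    using mc(2) by (intro exec_bounded_state[OF s2(1) t1(3)]) simp
  moreover have "max_const read_answer \<le> ?L + ?k + t\<^sub>2"
    using mc(3) by simp
  ultimately obtain t\<^sub>3 where t3: "exec read_answer s\<^sub>2 t\<^sub>3 s\<^sub>3" "t\<^sub>3 \<le> ?l * (2 * (?L + ?k + t\<^sub>2 + ?l) + 2)"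
    using s3(1) unfolding runs_def by blast
  have "exec (reduction P) ?s (t\<^sub>1 + (t\<^sub>2 + t\<^sub>3)) s\<^sub>3"
    unfolding reduction_def by (intro exec.Seq[OF t1(1)] exec.Seq[OF s2(1)] t3(1))
  moreover have "t\<^sub>1 + (t\<^sub>2 + t\<^sub>3) \<le> overhead P n ?m + (2 * ?l + 1) * t\<^sub>2"
    using t1(2) t3(2) unfolding overhead_def by (simp add: algebra_simps)
  ultimately show ?thesis
    using p(2) opt by blast
qed

lemma overhead_mono: "m \<le> m' \<Longrightarrow> overhead P n m \<le> overhead P n m'"
  unfolding overhead_def bits_def build_steps_def
  by (intro add_le_mono mult_le_mono order.refl) auto

text \<open>Replacing \<epsilon> by \<open>min \<epsilon> 1\<close> keeps the base at least 1, so
  that the exponential factor can absorb the additive overhead.\<close>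

lemma reduction_solves_max_3sat:
  assumes "0 < \<epsilon>" "\<epsilon> < 2" "poly_bounded f"
    and P: "solves_max_cut_with_hub 7 4 P (\<lambda>n p. (2 - \<epsilon>) ^ p * real (f n))"
  shows "\<exists>g. poly_bounded g \<and> solves_max_3sat (reduction P) (\<lambda>n. (2 - min \<epsilon> 1) ^ n * real (g n))"
proof -
  obtain c k where f: "\<And>n. f n \<le> c * (n + 1) ^ k"
    using assms(3) unfolding poly_bounded_iff by blast
  define M where "M n = 4 * (2 * n + 1) ^ 3" for n :: nat
  \<comment> \<open>The hub has \<open>n + 1\<close> vertices; the reference vertex costs one more
    factor of at most 2. \<open>M n\<close> bounds the number of clauses, hence
    \<open>Suc n + 7 * M n\<close> the number of vertices.\<close>
  define g where "g n = overhead P n (M n) +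
    (2 * answer_steps n + 1) * (2 * (c * (Suc n + 7 * M n + 1) ^ k))" for n
  have "poly_bounded g"
    unfolding g_def overhead_def bits_def build_steps_def answer_steps_def M_def
    by (intro poly_bounded_intros)
  moreover have "solves_max_3sat (reduction P) (\<lambda>n. (2 - min \<epsilon> 1) ^ n * real (g n))"
    unfolding solves_max_3sat_def computes_within_def
  proof (intro allI impI, elim conjE)
    fix n F cs
    assume F: "three_cnf n F" "cnf_listing cs F"
    let ?N = "Suc n + 7 * length cs" and ?b = "2 - min \<epsilon> 1" and ?a = "2 * answer_steps n + 1"
    obtain t s t' where t: "exec (reduction P) (input_state (encode_cnf n cs)) t s"
      "real t' \<le> (2 - \<epsilon>) ^ Suc n * real (f ?N)"
      "t \<le> overhead P n (length cs) + ?a * t'" "max_sat_optimal F (\<lambda>x. arrs s 1 x \<noteq> 0)"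
      using exec_reduction[OF F P] by blast
    have m: "length cs \<le> M n"
      using length_cnf_le[OF F] by (simp add: M_def)
    have "f ?N \<le> c * (?N + 1) ^ k"
      by (rule f)
    also have "\<dots> \<le> c * (Suc n + 7 * M n + 1) ^ k"
      using m by (intro mult_le_mono2 power_mono) auto
    finally have fN: "real (f ?N) \<le> real (c * (Suc n + 7 * M n + 1) ^ k)"
      by (simp only: of_nat_le_iff)
    have b: "(2 - \<epsilon>) ^ Suc n \<le> ?b ^ n * 2" "1 \<le> ?b ^ n"
    proof -
      have "(2 - \<epsilon>) ^ Suc n \<le> ?b ^ Suc n"
        using assms(1,2) by (intro power_mono) auto
      also have "\<dots> = ?b ^ n * ?b"
        by simp
      also have "\<dots> \<le> ?b ^ n * 2"
        using assms(1) by (intro mult_left_mono) auto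
      finally show "(2 - \<epsilon>) ^ Suc n \<le> ?b ^ n * 2" .
      show "1 \<le> ?b ^ n"
        by (intro one_le_power) auto
    qed
    have "real t' \<le> (?b ^ n * 2) * real (c * (Suc n + 7 * M n + 1) ^ k)"
      using t(2) mult_mono[OF b(1) fN] b(2) by simp
    then have t': "real t' \<le> ?b ^ n * real (2 * (c * (Suc n + 7 * M n + 1) ^ k))"
      by (simp only: of_nat_mult of_nat_numeral mult.assoc)
    have "real t \<le> real (overhead P n (M n) + ?a * t')"
      using t(3) overhead_mono[OF m, of P n] unfolding of_nat_le_iff by linarith
    also have "\<dots> = real (overhead P n (M n)) + real ?a * real t'"
      by (simp only: of_nat_add of_nat_mult)
    also have "\<dots> \<le> ?b ^ n * real (overhead P n (M n)) +
        real ?a * (?b ^ n * real (2 * (c * (Suc n + 7 * M n + 1) ^ k)))"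
    proof (intro add_mono mult_left_mono t')
      show "real (overhead P n (M n)) \<le> ?b ^ n * real (overhead P n (M n))"
        using mult_right_mono[OF b(2), of "real (overhead P n (M n))"] by simp
    qed simp
    also have "\<dots> = ?b ^ n * real (g n)"
      unfolding g_def of_nat_add[of "overhead P n (M n)"] of_nat_mult[of ?a] by (simp only: algebra_simps)
    finally show "\<exists>t s. exec (reduction P) (input_state (encode_cnf n cs)) t s \<and>
        real t \<le> ?b ^ n * real (g n) \<and> max_sat_optimal F (\<lambda>x. arrs s 1 x \<noteq> 0)"
      using t(1,4) by blast
  qed
  ultimately show ?thesis
    by blast
qed

text \<open>On a single vertex forming the hub, the time bound is \<open>b * real (f 1)\<close>, yet
  every run takes at least one time unit.\<close>

lemma max_cut_base_positive:
  assumes "solves_max_cut_with_hub \<sigma> \<delta> P (\<lambda>n p. b ^ p * real (f n))"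
  shows "b > 0"
proof (rule ccontr)
  assume b: "\<not> b > 0"
  have "hub \<sigma> \<delta> {..<1} {} {0::nat}" "simple_graph {..<1::nat} {}"
    by (auto simp: hub_def components_def simple_graph_def)
  moreover have "edge_listing [] {}"
    by (simp add: edge_listing_def)
  ultimately have "computes_within P (encode_graph_hub 1 [] [0]) (b ^ card {0::nat} * real (f 1))
      (\<lambda>out. is_max_cut {..<1} {} {v. v < 1 \<and> out v \<noteq> 0})"
    using assms[unfolded solves_max_cut_with_hub_def, rule_format, of 1 "{}" "{0}" "[]" "[0]"] by simp
  then obtain t s where "exec P (input_state (encode_graph_hub 1 [] [0])) t s" "real t \<le> b * real (f 1)"
    unfolding computes_within_def by auto
  moreover have "b * real (f 1) \<le> 0"
    using b by (simp add: mult_nonpos_nonneg)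
  ultimately show False
    using exec_time_pos[of P _ t s] by fastforce
qed

theorem theorem6p2:
  "\<exists>\<sigma>::nat. \<forall>\<epsilon>::real. \<epsilon> > 0 \<longrightarrow> M3SH \<longrightarrow>
     \<not> (\<exists>P f. poly_bounded f \<and>
          solves_max_cut_with_hub \<sigma> 4 P (\<lambda>n p. (2 - \<epsilon>) ^ p * real (f n)))"
\<comment> \<open>A block has seven vertices: three ports, three inner vertices and the free
  vertex.\<close>
proof (intro exI[of _ 7] allI impI notI)
  fix \<epsilon> :: real
  assume "\<epsilon> > 0" M3SH
    and "\<exists>P f. poly_bounded f \<and> solves_max_cut_with_hub 7 4 P (\<lambda>n p. (2 - \<epsilon>) ^ p * real (f n))"
  then obtain P f where Pf: "poly_bounded f"
    "solves_max_cut_with_hub 7 4 P (\<lambda>n p. (2 - \<epsilon>) ^ p * real (f n))"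
    by blast
  have "\<epsilon> < 2"
    using max_cut_base_positive[OF Pf(2)] by simp
  then obtain g where "poly_bounded g"
    "solves_max_3sat (reduction P) (\<lambda>n. (2 - min \<epsilon> 1) ^ n * real (g n))"
    using reduction_solves_max_3sat[OF \<open>\<epsilon> > 0\<close> _ Pf] by blast
  moreover have "min \<epsilon> 1 > 0"
    using \<open>\<epsilon> > 0\<close> by simp
  ultimately show False
    using \<open>M3SH\<close> unfolding M3SH_def by blast
qed

end
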